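(* Let $\mathcal A$ be an abelian category and let $\mathcal E\subseteq\mathcal A$ be a full extension-closed subcategory equipped with the exact structure induced from $\mathcal A$. Assume that $\mathcal E$ has enough projective objects. Let $T\in\operatorname{Proj}\mathcal E$, let $X\in\mathcal E$, and let $k\ge1$. Suppose $$m=k\text{-}\operatorname{ddell}_{\mathcal E}X<\infty$$ and $$\operatorname{Ext}_{\mathcal A}^j(T,P)=0\qquad(P\in\operatorname{Proj}\mathcal E,\ 2\le j\le m+k+1).$$ Then $$\operatorname{Ext}_{\mathcal A}^{k+1}(T,X)=0 .$$
   Context: All exact categories are assumed essentially small and idempotent complete. $\operatorname{Ext}_{\mathcal A}$ denotes Yoneda Ext groups in $\mathcal A$. For an exact category $\mathcal E$ with enough projectives: short exact sequences of the exact structure are called conflations. For each $X\in\mathcal E$ fix a conflation $0\to\Omega_{\mathcal E}X\to P_X\to X\to0$ with $P_X$ projective. The stable category $\underline{\mathcal E}=\mathcal E/[\operatorname{Proj}\mathcal E]$ has morphisms modulo those factoring through projectives, and $\Omega_{\mathcal E}$ is an endofunctor of it. $X$ is a stable retract of $Y$ if there are $u:X\to Y$, $v:Y\to X$ in $\underline{\mathcal E}$ with $vu=1_X$. For $k\ge1$, $$k\text{-}\operatorname{dell}_{\mathcal E}X=\inf\{n\ge0\mid \Omega_{\mathcal E}^nX\text{ is a stable retract of }\Omega_{\mathcal E}^{n+k}Y\text{ for some }Y\in\mathcal E\}.$$ A sequence $0\to C_t\to\cdots\to C_0\to X\to0$ is admissibly exact if there are objects $Z_0=X,Z_1,\dots,Z_t=C_t$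 and conflations $0\to Z_{i+1}\to C_i\to Z_i\to0$ for $0\le i<t$ from which it is spliced (for $t=0$: $C_0\to X$ is an isomorphism). $k\text{-}\operatorname{ddell}_{\mathcal E}X$ is the infimum of the integers $m\ge0$ such that there are $0\le t\le m$ and an admissibly exact sequence $0\to C_t\to\cdots\to C_0\to X\to0$ with $(i+k)\text{-}\operatorname{dell}_{\mathcal E}C_i\le m-i$ for $0\le i\le t$. ($\inf\emptyset=\infty$.) *)

theory Defs
  imports "HOL-Algebra.Group" "HOL-Library.Extended_Nat"
begin

section \<open>Categories\<close>

record ('o, 'm) category =
  Obj :: "'o set"
  Arr :: "'m set"
  Dom :: "'m \<Rightarrow> 'o"
  Cod :: "'m \<Rightarrow> 'o"
  Comp :: "'m \<Rightarrow> 'm \<Rightarrow> 'm"  (infixr \<open>\<cdot>\<index>\<close> 70)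
  Ident :: "'o \<Rightarrow> 'm"

definition Hom :: "('o, 'm, 'z) category_scheme \<Rightarrow> 'o \<Rightarrow> 'o \<Rightarrow> 'm set"
  where "Hom C X Y = {f \<in> Arr C. Dom C f = X \<and> Cod C f = Y}"

locale category =
  fixes C (structure)
  assumes Dom_closed: "f \<in> Arr C \<Longrightarrow> Dom C f \<in> Obj C"
    and Cod_closed: "f \<in> Arr C \<Longrightarrow> Cod C f \<in> Obj C"
    and Ident_Hom: "X \<in> Obj C \<Longrightarrow> Ident C X \<in> Hom C X X"
    and Comp_Hom: "\<lbrakk>f \<in> Hom C X Y; g \<in> Hom C Y Z\<rbrakk> \<Longrightarrow> g \<cdot> f \<in> Hom C X Z"
    and Comp_assoc: "\<lbrakk>f \<in> Hom C W X; g \<in> Hom C X Y; h \<in> Hom C Y Z\<rbrakk>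
      \<Longrightarrow> (h \<cdot> g) \<cdot> f = h \<cdot> (g \<cdot> f)"
    and Comp_Ident_left: "f \<in> Hom C X Y \<Longrightarrow> Ident C Y \<cdot> f = f"
    and Comp_Ident_right: "f \<in> Hom C X Y \<Longrightarrow> f \<cdot> Ident C X = f"

definition monic :: "('o, 'm, 'z) category_scheme \<Rightarrow> 'm \<Rightarrow> bool"
  where "monic C f \<longleftrightarrow> f \<in> Arr C \<and>
    (\<forall>W. \<forall>u \<in> Hom C W (Dom C f). \<forall>v \<in> Hom C W (Dom C f).
      f \<cdot>\<^bsub>C\<^esub> u = f \<cdot>\<^bsub>C\<^esub> v \<longrightarrow> u = v)"

definition epic :: "('o, 'm, 'z) category_scheme \<Rightarrow> 'm \<Rightarrow> bool"
  where "epic C f \<longleftrightarrow> f \<in> Arr C \<and>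
    (\<forall>W. \<forall>u \<in> Hom C (Cod C f) W. \<forall>v \<in> Hom C (Cod C f) W.
      u \<cdot>\<^bsub>C\<^esub> f = v \<cdot>\<^bsub>C\<^esub> f \<longrightarrow> u = v)"

definition iso_arr :: "('o, 'm, 'z) category_scheme \<Rightarrow> 'm \<Rightarrow> bool"
  where "iso_arr C f \<longleftrightarrow> f \<in> Arr C \<and>
    (\<exists>g \<in> Hom C (Cod C f) (Dom C f).
      g \<cdot>\<^bsub>C\<^esub> f = Ident C (Dom C f) \<and> f \<cdot>\<^bsub>C\<^esub> g = Ident C (Cod C f))"

definition is_retract :: "('o, 'm, 'z) category_scheme \<Rightarrow> 'o \<Rightarrow> 'o \<Rightarrow> bool"
  where "is_retract C X Y \<longleftrightarrow>
    (\<exists>u \<in> Hom C X Y. \<exists>v \<in> Hom C Y X. v \<cdot>\<^bsub>C\<^esub> u = Ident C X)"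

definition zero_object :: "('o, 'm, 'z) category_scheme \<Rightarrow> 'o \<Rightarrow> bool"
  where "zero_object C Z \<longleftrightarrow> Z \<in> Obj C \<and>
    (\<forall>X \<in> Obj C. (\<exists>!f. f \<in> Hom C X Z) \<and> (\<exists>!f. f \<in> Hom C Z X))"


section \<open>Abelian categories\<close>

record ('o, 'm) preadditive_category = "('o, 'm) category" +
  Add :: "'m \<Rightarrow> 'm \<Rightarrow> 'm"  (infixl \<open>\<oplus>\<index>\<close> 65)
  Zero :: "'o \<Rightarrow> 'o \<Rightarrow> 'm"

definition Hom_group ::
    "('o, 'm, 'z) preadditive_category_scheme \<Rightarrow> 'o \<Rightarrow> 'o \<Rightarrow> 'm monoid"
  where "Hom_group C X Y = \<lparr>carrier = Hom C X Y, mult = Add C, one = Zero C X Y\<rparr>"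

locale preadditive_category = category C for C (structure) +
  assumes Hom_comm_group:
      "\<lbrakk>X \<in> Obj C; Y \<in> Obj C\<rbrakk> \<Longrightarrow> comm_group (Hom_group C X Y)"
    and Comp_Add_right: "\<lbrakk>f \<in> Hom C X Y; f' \<in> Hom C X Y; g \<in> Hom C Y Z\<rbrakk>
      \<Longrightarrow> g \<cdot> (f \<oplus> f') = g \<cdot> f \<oplus> g \<cdot> f'"
    and Comp_Add_left: "\<lbrakk>f \<in> Hom C X Y; g \<in> Hom C Y Z; g' \<in> Hom C Y Z\<rbrakk>
      \<Longrightarrow> (g \<oplus> g') \<cdot> f = g \<cdot> f \<oplus> g' \<cdot> f"

definition is_kernel :: "('o, 'm, 'z) preadditive_category_scheme \<Rightarrow> 'm \<Rightarrow> 'm \<Rightarrow> bool"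
  where "is_kernel C k f \<longleftrightarrow> k \<in> Arr C \<and> f \<in> Arr C \<and> Cod C k = Dom C f \<and>
    f \<cdot>\<^bsub>C\<^esub> k = Zero C (Dom C k) (Cod C f) \<and>
    (\<forall>W. \<forall>h \<in> Hom C W (Dom C f). f \<cdot>\<^bsub>C\<^esub> h = Zero C W (Cod C f) \<longrightarrow>
      (\<exists>!u. u \<in> Hom C W (Dom C k) \<and> k \<cdot>\<^bsub>C\<^esub> u = h))"

definition is_cokernel :: "('o, 'm, 'z) preadditive_category_scheme \<Rightarrow> 'm \<Rightarrow> 'm \<Rightarrow> bool"
  where "is_cokernel C c f \<longleftrightarrow> c \<in> Arr C \<and> f \<in> Arr C \<and> Dom C c = Cod C f \<and>
    c \<cdot>\<^bsub>C\<^esub> f = Zero C (Dom C f) (Cod C c) \<and>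
    (\<forall>W. \<forall>h \<in> Hom C (Cod C f) W. h \<cdot>\<^bsub>C\<^esub> f = Zero C (Dom C f) W \<longrightarrow>
      (\<exists>!u. u \<in> Hom C (Cod C c) W \<and> u \<cdot>\<^bsub>C\<^esub> c = h))"

definition is_biproduct :: "('o, 'm, 'z) preadditive_category_scheme \<Rightarrow>
    'o \<Rightarrow> 'o \<Rightarrow> 'o \<Rightarrow> 'm \<Rightarrow> 'm \<Rightarrow> 'm \<Rightarrow> 'm \<Rightarrow> bool"
  where "is_biproduct C X Y B i j p q \<longleftrightarrow> B \<in> Obj C \<and>
    i \<in> Hom C X B \<and> j \<in> Hom C Y B \<and> p \<in> Hom C B X \<and> q \<in> Hom C B Y \<and>
    p \<cdot>\<^bsub>C\<^esub> i = Ident C X \<and> q \<cdot>\<^bsub>C\<^esub> j = Ident C Y \<and>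
    q \<cdot>\<^bsub>C\<^esub> i = Zero C X Y \<and> p \<cdot>\<^bsub>C\<^esub> j = Zero C Y X \<and>
    (i \<cdot>\<^bsub>C\<^esub> p) \<oplus>\<^bsub>C\<^esub> (j \<cdot>\<^bsub>C\<^esub> q) = Ident C B"

locale abelian_category = preadditive_category C for C (structure) +
  assumes zero_object_exists: "\<exists>Z. zero_object C Z"
    and biproduct_exists:
      "\<lbrakk>X \<in> Obj C; Y \<in> Obj C\<rbrakk> \<Longrightarrow> \<exists>B i j p q. is_biproduct C X Y B i j p q"
    and kernel_exists: "f \<in> Arr C \<Longrightarrow> \<exists>k. is_kernel C k f"
    and cokernel_exists: "f \<in> Arr C \<Longrightarrow> \<exists>c. is_cokernel C c f"
    and monic_is_kernel: "monic C f \<Longrightarrow> \<exists>g. is_kernel C f g"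
    and epic_is_cokernel: "epic C f \<Longrightarrow> \<exists>g. is_cokernel C f g"

definition short_exact :: "('o, 'm, 'z) preadditive_category_scheme \<Rightarrow> 'm \<Rightarrow> 'm \<Rightarrow> bool"
  where "short_exact C f g \<longleftrightarrow> is_kernel C f g \<and> is_cokernel C g f"

definition is_image :: "('o, 'm, 'z) preadditive_category_scheme \<Rightarrow> 'm \<Rightarrow> 'm \<Rightarrow> bool"
  where "is_image C k f \<longleftrightarrow> (\<exists>c. is_cokernel C c f \<and> is_kernel C k c)"

definition exact_at :: "('o, 'm, 'z) preadditive_category_scheme \<Rightarrow> 'm \<Rightarrow> 'm \<Rightarrow> bool"
  where "exact_at C f g \<longleftrightarrow> (\<exists>k. is_image C k f \<and> is_kernel C k g)"


section \<open>Yoneda Ext\<close>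

text \<open>
  An \<open>n\<close>-extension (\<open>n \<ge> 1\<close>) of \<open>T\<close> by \<open>X\<close> is an exact sequence
  \<open>0 \<rightarrow> X \<rightarrow> M\<^sub>1 \<rightarrow> \<dots> \<rightarrow> M\<^sub>n \<rightarrow> T \<rightarrow> 0\<close>, given as the list of its \<open>n + 1\<close> inner arrows
  in this order.
\<close>

definition is_extension ::
    "('o, 'm, 'z) preadditive_category_scheme \<Rightarrow> nat \<Rightarrow> 'o \<Rightarrow> 'o \<Rightarrow> 'm list \<Rightarrow> bool"
  where "is_extension C n T X e \<longleftrightarrow>
    length e = Suc n \<and> Dom C (e ! 0) = X \<and> Cod C (e ! n) = T \<and>
    monic C (e ! 0) \<and> epic C (e ! n) \<and> (\<forall>i<n. exact_at C (e ! i) (e ! Suc i))"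

text \<open>There is a map of extensions, with identities at both ends, from \<open>e\<close> to \<open>e'\<close>.\<close>

definition extension_map :: "('o, 'm, 'z) preadditive_category_scheme \<Rightarrow>
    nat \<Rightarrow> 'o \<Rightarrow> 'o \<Rightarrow> 'm list \<Rightarrow> 'm list \<Rightarrow> bool"
  where "extension_map C n T X e e' \<longleftrightarrow>
    is_extension C n T X e \<and> is_extension C n T X e' \<and>
    (\<exists>h. h 0 = Ident C X \<and> h (Suc n) = Ident C T \<and>
      (\<forall>i\<in>{1..n}. h i \<in> Hom C (Dom C (e ! i)) (Dom C (e' ! i))) \<and>
      (\<forall>i\<le>n. e' ! i \<cdot>\<^bsub>C\<^esub> h i = h (Suc i) \<cdot>\<^bsub>C\<^esub> e ! i))"

definition Ext_rel :: "('o, 'm, 'z) preadditive_category_scheme \<Rightarrow>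
    nat \<Rightarrow> 'o \<Rightarrow> 'o \<Rightarrow> ('m list \<times> 'm list) set"
  where "Ext_rel C n T X = {(e, e').
    is_extension C n T X e \<and> is_extension C n T X e' \<and>
    equivclp (extension_map C n T X) e e'}"

definition Ext :: "('o, 'm, 'z) preadditive_category_scheme \<Rightarrow>
    nat \<Rightarrow> 'o \<Rightarrow> 'o \<Rightarrow> 'm list set set"
  where "Ext C n T X = {e. is_extension C n T X e} // Ext_rel C n T X"

text \<open>
  The neutral element for the Baer sum is the class of the split extension
  \<open>0 \<rightarrow> X \<rightarrow> X \<oplus> T \<rightarrow> T \<rightarrow> 0\<close> if \<open>n = 1\<close>, and of
  \<open>0 \<rightarrow> X = X \<rightarrow> 0 \<rightarrow> \<dots> \<rightarrow> 0 \<rightarrow> T = T \<rightarrow> 0\<close> if \<open>n \<ge> 2\<close>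
  (middle arrow \<open>X \<rightarrow> T\<close> zero if \<open>n = 2\<close>).
\<close>

definition trivial_extension ::
    "('o, 'm, 'z) preadditive_category_scheme \<Rightarrow> nat \<Rightarrow> 'o \<Rightarrow> 'o \<Rightarrow> 'm list \<Rightarrow> bool"
  where "trivial_extension C n T X e \<longleftrightarrow>
    (if n = 1 then \<exists>B i j p q. is_biproduct C X T B i j p q \<and> e = [i, q]
     else \<exists>Z. zero_object C Z \<and>
       (let M = (\<lambda>i. if i = 1 then X else if i = n then T else Z)
        in e = Ident C X # map (\<lambda>i. Zero C (M i) (M (Suc i))) [1..<n] @ [Ident C T]))"

definition Ext_zero :: "('o, 'm, 'z) preadditive_category_scheme \<Rightarrow>
    nat \<Rightarrow> 'o \<Rightarrow> 'o \<Rightarrow> 'm list set"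
  where "Ext_zero C n T X = Ext_rel C n T X `` {e. trivial_extension C n T X e}"

text \<open>
  A group is zero when its only element is the neutral one, so the Baer sum itself
  is not needed to express vanishing.
\<close>

definition Ext_vanishes ::
    "('o, 'm, 'z) preadditive_category_scheme \<Rightarrow> nat \<Rightarrow> 'o \<Rightarrow> 'o \<Rightarrow> bool"
  where "Ext_vanishes C n T X \<longleftrightarrow> Ext C n T X = {Ext_zero C n T X}"


section \<open>Extension-closed subcategories with the induced exact structure\<close>

text \<open>A full subcategory of \<open>A\<close> is given by its set \<open>E\<close> of objects.\<close>

definition extension_closed_subcategory ::
    "('o, 'm, 'z) preadditive_category_scheme \<Rightarrow> 'o set \<Rightarrow> bool"
  where "extension_closed_subcategory A E \<longleftrightarrow>
    E \<subseteq> Obj A \<and> (\<exists>Z \<in> E. zero_object A Z) \<and>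
    (\<forall>f g. short_exact A f g \<longrightarrow> Dom A f \<in> E \<longrightarrow> Cod A g \<in> E \<longrightarrow> Cod A f \<in> E)"

definition idempotent_complete ::
    "('o, 'm, 'z) category_scheme \<Rightarrow> 'o set \<Rightarrow> bool"
  where "idempotent_complete A E \<longleftrightarrow>
    (\<forall>X \<in> E. \<forall>e \<in> Hom A X X. e \<cdot>\<^bsub>A\<^esub> e = e \<longrightarrow>
      (\<exists>Y \<in> E. \<exists>r \<in> Hom A X Y. \<exists>s \<in> Hom A Y X.
        s \<cdot>\<^bsub>A\<^esub> r = e \<and> r \<cdot>\<^bsub>A\<^esub> s = Ident A Y))"

definition conflation ::
    "('o, 'm, 'z) preadditive_category_scheme \<Rightarrow> 'o set \<Rightarrow> 'm \<Rightarrow> 'm \<Rightarrow> bool"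
  where "conflation A E f g \<longleftrightarrow>
    short_exact A f g \<and> Dom A f \<in> E \<and> Cod A f \<in> E \<and> Cod A g \<in> E"

definition Proj :: "('o, 'm, 'z) preadditive_category_scheme \<Rightarrow> 'o set \<Rightarrow> 'o set"
  where "Proj A E = {P \<in> E. \<forall>f g. conflation A E f g \<longrightarrow>
    (\<forall>h \<in> Hom A P (Cod A g). \<exists>h' \<in> Hom A P (Dom A g). g \<cdot>\<^bsub>A\<^esub> h' = h)}"

definition enough_projectives ::
    "('o, 'm, 'z) preadditive_category_scheme \<Rightarrow> 'o set \<Rightarrow> bool"
  where "enough_projectives A E \<longleftrightarrow>
    (\<forall>X \<in> E. \<exists>f g. conflation A E f g \<and> Cod A g = X \<and> Dom A g \<in> Proj A E)"


section \<open>The stable category\<close>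

text \<open>Congruence of arrows of \<open>E\<close> modulo the ideal of arrows factoring through projectives.\<close>

definition stable_rel ::
    "('o, 'm, 'z) preadditive_category_scheme \<Rightarrow> 'o set \<Rightarrow> ('m \<times> 'm) set"
  where "stable_rel A E = {(f, g). \<exists>X \<in> E. \<exists>Y \<in> E. f \<in> Hom A X Y \<and> g \<in> Hom A X Y \<and>
    (\<exists>P \<in> Proj A E. \<exists>a \<in> Hom A X P. \<exists>b \<in> Hom A P Y. f = g \<oplus>\<^bsub>A\<^esub> (b \<cdot>\<^bsub>A\<^esub> a))}"

definition stable_category ::
    "('o, 'm, 'z) preadditive_category_scheme \<Rightarrow> 'o set \<Rightarrow> ('o, 'm set) category"
  where "stable_category A E =
    \<lparr>Obj = E,
     Arr = {f \<in> Arr A. Dom A f \<in> E \<and> Cod A f \<in> E} // stable_rel A E,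
     Dom = (\<lambda>F. the_elem (Dom A ` F)),
     Cod = (\<lambda>F. the_elem (Cod A ` F)),
     Comp = (\<lambda>G F. \<Union>g\<in>G. \<Union>f\<in>F. stable_rel A E `` {g \<cdot>\<^bsub>A\<^esub> f}),
     Ident = (\<lambda>X. stable_rel A E `` {Ident A X})\<rparr>"

definition stable_retract ::
    "('o, 'm, 'z) preadditive_category_scheme \<Rightarrow> 'o set \<Rightarrow> 'o \<Rightarrow> 'o \<Rightarrow> bool"
  where "stable_retract A E X Y \<longleftrightarrow> is_retract (stable_category A E) X Y"


section \<open>Delooping levels\<close>

text \<open>
  \<open>\<iota> X\<close> and \<open>\<pi> X\<close> are the arrows of the conflation \<open>0 \<rightarrow> \<Omega>X \<rightarrow> P\<^sub>X \<rightarrow> X \<rightarrow> 0\<close>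
  fixed for \<open>X\<close>.
\<close>

definition syzygy_choice :: "('o, 'm, 'z) preadditive_category_scheme \<Rightarrow> 'o set \<Rightarrow>
    ('o \<Rightarrow> 'm) \<Rightarrow> ('o \<Rightarrow> 'm) \<Rightarrow> bool"
  where "syzygy_choice A E \<iota> \<pi> \<longleftrightarrow>
    (\<forall>X \<in> E. conflation A E (\<iota> X) (\<pi> X) \<and> Cod A (\<pi> X) = X \<and> Dom A (\<pi> X) \<in> Proj A E)"

definition syzygy :: "('o, 'm, 'z) preadditive_category_scheme \<Rightarrow> ('o \<Rightarrow> 'm) \<Rightarrow> 'o \<Rightarrow> 'o"
  where "syzygy A \<iota> X = Dom A (\<iota> X)"

definition dell :: "('o, 'm, 'z) preadditive_category_scheme \<Rightarrow> 'o set \<Rightarrow> ('o \<Rightarrow> 'm) \<Rightarrow>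
    nat \<Rightarrow> 'o \<Rightarrow> enat"
  where "dell A E \<iota> k X = Inf {enat n | n. \<exists>Y \<in> E.
    stable_retract A E ((syzygy A \<iota> ^^ n) X) ((syzygy A \<iota> ^^ (n + k)) Y)}"

text \<open>
  The sequence \<open>0 \<rightarrow> C\<^sub>t \<rightarrow> \<dots> \<rightarrow> C\<^sub>0 \<rightarrow> X \<rightarrow> 0\<close> has arrows \<open>d\<^sub>0 : C\<^sub>0 \<rightarrow> X\<close> and
  \<open>d\<^sub>i : C\<^sub>i \<rightarrow> C\<^sub>i\<^sub>-\<^sub>1\<close> for \<open>0 < i \<le> t\<close>; it is spliced from
  \<open>0 \<rightarrow> Z\<^sub>i\<^sub>+\<^sub>1 \<rightarrow> C\<^sub>i \<rightarrow> Z\<^sub>i \<rightarrow> 0\<close> (\<open>0 \<le> i < t\<close>) with arrows \<open>j\<^sub>i\<close> and \<open>q\<^sub>i\<close>.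
\<close>

definition admissibly_exact :: "('o, 'm, 'z) preadditive_category_scheme \<Rightarrow> 'o set \<Rightarrow>
    nat \<Rightarrow> (nat \<Rightarrow> 'o) \<Rightarrow> (nat \<Rightarrow> 'm) \<Rightarrow> 'o \<Rightarrow> bool"
  where "admissibly_exact A E t C d X \<longleftrightarrow>
    X \<in> E \<and> (\<forall>i\<le>t. C i \<in> E) \<and>
    (if t = 0 then d 0 \<in> Hom A (C 0) X \<and> iso_arr A (d 0)
     else \<exists>Z j q. Z 0 = X \<and> Z t = C t \<and>
       (\<forall>i<t. conflation A E (j i) (q i) \<and>
         j i \<in> Hom A (Z (Suc i)) (C i) \<and> q i \<in> Hom A (C i) (Z i)) \<and>
       d 0 = q 0 \<and> (\<forall>i. Suc i < t \<longrightarrow> d (Suc i) = j i \<cdot>\<^bsub>A\<^esub> q (Suc i)) \<and>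
       d t = j (t - 1))"

definition ddell :: "('o, 'm, 'z) preadditive_category_scheme \<Rightarrow> 'o set \<Rightarrow> ('o \<Rightarrow> 'm) \<Rightarrow>
    nat \<Rightarrow> 'o \<Rightarrow> enat"
  where "ddell A E \<iota> k X = Inf {enat m | m. \<exists>t\<le>m. \<exists>C d.
    admissibly_exact A E t C d X \<and> (\<forall>i\<le>t. dell A E \<iota> (i + k) (C i) \<le> enat (m - i))}"

end

theory Submission
  imports Defs
begin

text \<open>
  Represent a class in \<open>Ext\<^sup>n(T, X)\<close> by an exact sequence
  \<open>0 \<rightarrow> K \<rightarrow> N\<^sub>n \<rightarrow> \<dots> \<rightarrow> N\<^sub>1 \<rightarrow> T \<rightarrow> 0\<close> and an arrow \<open>K \<rightarrow> X\<close>. The class is zero iff,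
  after replacing the sequence by one mapping to it over \<open>T\<close>, the arrow extends over the first
  middle term. With this criterion the vanishing consequences of the long exact sequence of a short
  exact sequence \<open>0 \<rightarrow> A \<rightarrow> B \<rightarrow> D \<rightarrow> 0\<close> are direct diagram chases, without enough projectives or
  injectives and without the Baer sum.

  Since \<open>Ext\<^sup>1(T, -)\<close> vanishes on \<open>E\<close> and \<open>Ext\<^sup>j(T, -)\<close> vanishes on projectives,
  \<open>Ext\<^sup>n\<^sup>+\<^sup>k\<^sup>+\<^sup>1(T, \<Omega>\<^sup>n\<^sup>+\<^sup>kY)\<close> is zero by dimension shifting. It has
  \<open>Ext\<^sup>n\<^sup>+\<^sup>k\<^sup>+\<^sup>1(T, \<Omega>\<^sup>nC)\<close> as a retract if \<open>\<Omega>\<^sup>nC\<close> is a stable retract of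
  \<open>\<Omega>\<^sup>n\<^sup>+\<^sup>kY\<close>, and shifting back gives \<open>Ext\<^sup>k\<^sup>+\<^sup>1(T, C) = 0\<close>. Applied to the terms
  \<open>C\<^sub>i\<close> of the sequence computing \<open>k\<close>-ddell with \<open>i + k\<close> in place of \<open>k\<close>, this
  propagates along the sequence from left to right.
\<close>

section \<open>Preadditive categories\<close>

text \<open>The Ext groups are those of the ambient category, which need not have enough projectives
  or injectives, while \<open>T\<close> is projective only relative to conflations in
  \<open>E\<close>. This settles degree 1, because an extension of \<open>T\<close> by an object of
  \<open>E\<close> stays in \<open>E\<close>. A longer extension may have middle terms outside
  \<open>E\<close>, so in higher degrees vanishing must be imported from the projectives.

  The range of degrees is what this consumes: a term with (i + k)-dell at most m - i is handled in
  degrees up to (m - i) + (i + k) + 1 = m + k + 1, whatever i is.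

  Lifting against a projective is replaced by enlarging a middle term through a pullback, which is
  why the chases produce refinements. As Yoneda equivalence is a zigzag, effacement must be
  invariant in both directions of a map of extensions. One direction is composition. In the other,
  two maps into one resolution agree only up to homotopy after refinement; the homotopy term extends
  over the first middle term by itself and is harmless.\<close>

context category
begin

text \<open>Membership is split into the \<open>Arr\<close>, \<open>Dom\<close> and
  \<open>Cod\<close> facts on which the simplification rules match; the objects are added because
  the rules for identities and zero arrows ask for them.\<close>

lemma Hom_iff:
  "f \<in> Hom C X Y \<longleftrightarrow> f \<in> Arr C \<and> Dom C f = X \<and> Cod C f = Y \<and> X \<in> Obj C \<and> Y \<in> Obj C"
  by (auto simp: Hom_def Dom_closed Cod_closed)

lemma arr_Hom: "f \<in> Arr C \<Longrightarrow> f \<in> Hom C (Dom C f) (Cod C f)"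
  by (simp add: Hom_def)

lemma comp_simps [simp]:
  assumes "f \<in> Arr C" "g \<in> Arr C" "Cod C f = Dom C g"
  shows "g \<cdot> f \<in> Arr C" "Dom C (g \<cdot> f) = Dom C f" "Cod C (g \<cdot> f) = Cod C g"
  using Comp_Hom[of f "Dom C f" "Dom C g" g "Cod C g"] assms by (auto simp: Hom_def)

lemma comp_assoc [simp]:
  assumes "f \<in> Arr C" "g \<in> Arr C" "h \<in> Arr C" "Cod C f = Dom C g" "Cod C g = Dom C h"
  shows "(h \<cdot> g) \<cdot> f = h \<cdot> (g \<cdot> f)"
  using assms by (intro Comp_assoc) (auto simp: Hom_def)

lemma ident_simps [simp]:
  assumes "X \<in> Obj C"
  shows "Ident C X \<in> Arr C" "Dom C (Ident C X) = X" "Cod C (Ident C X) = X"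
  using Ident_Hom[OF assms] by (auto simp: Hom_def)

lemma comp_ident [simp]:
  assumes "f \<in> Arr C"
  shows "Dom C f = X \<Longrightarrow> f \<cdot> Ident C X = f" "Cod C f = X \<Longrightarrow> Ident C X \<cdot> f = f"
  using assms by (auto intro: Comp_Ident_left Comp_Ident_right simp: Hom_def)

text \<open>Lets the simplifier apply an equation \<open>g \<cdot> f = h\<close> inside a right-associated composite.\<close>

lemma reassoc:
  assumes "g \<cdot> f = h" "f \<in> Arr C" "g \<in> Arr C" "Cod C f = Dom C g" "x \<in> Arr C" "Cod C x = Dom C f"
  shows "g \<cdot> (f \<cdot> x) = h \<cdot> x"
  using comp_assoc[of x f g] assms by simp

lemma monicD:
  "\<lbrakk>monic C f; f \<cdot> u = f \<cdot> v; u \<in> Arr C; v \<in> Arr C; Dom C u = Dom C v;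
    Cod C u = Dom C f; Cod C v = Dom C f\<rbrakk> \<Longrightarrow> u = v"
  unfolding monic_def by (auto simp: Hom_def)

lemma epicD:
  "\<lbrakk>epic C f; u \<cdot> f = v \<cdot> f; u \<in> Arr C; v \<in> Arr C; Cod C u = Cod C v;
    Dom C u = Cod C f; Dom C v = Cod C f\<rbrakk> \<Longrightarrow> u = v"
  unfolding epic_def by (auto simp: Hom_def)

lemma epic_comp: "\<lbrakk>epic C f; epic C g; Cod C f = Dom C g\<rbrakk> \<Longrightarrow> epic C (g \<cdot> f)"
  unfolding epic_def by (auto simp: Hom_def)

lemma epic_ident: "X \<in> Obj C \<Longrightarrow> epic C (Ident C X)"
  unfolding epic_def by (auto simp: Hom_def)

lemma monic_ident: "X \<in> Obj C \<Longrightarrow> monic C (Ident C X)"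
  unfolding monic_def by (auto simp: Hom_def)

end

context preadditive_category
begin

definition neg :: "'b \<Rightarrow> 'b"
  where "neg f = inv\<^bsub>Hom_group C (Dom C f) (Cod C f)\<^esub> f"

lemma Zero_simps [simp]:
  assumes "X \<in> Obj C" "Y \<in> Obj C"
  shows "Zero C X Y \<in> Arr C" "Dom C (Zero C X Y) = X" "Cod C (Zero C X Y) = Y"
proof -
  interpret comm_group "Hom_group C X Y" using assms by (rule Hom_comm_group)
  have "Zero C X Y \<in> Hom C X Y" using one_closed by (simp add: Hom_group_def)
  then show "Zero C X Y \<in> Arr C" "Dom C (Zero C X Y) = X" "Cod C (Zero C X Y) = Y"
    by (auto simp: Hom_def)
qed

lemma
  assumes "f \<in> Arr C" "g \<in> Arr C" "Dom C f = Dom C g" "Cod C f = Cod C g"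
  shows Add_simps [simp]:
      "f \<oplus> g \<in> Arr C" "Dom C (f \<oplus> g) = Dom C g" "Cod C (f \<oplus> g) = Cod C g"
    and Add_commute: "f \<oplus> g = g \<oplus> f"
proof -
  let ?G = "Hom_group C (Dom C g) (Cod C g)"
  interpret comm_group ?G
    using assms by (auto intro!: Hom_comm_group Dom_closed Cod_closed)
  have "f \<in> carrier ?G" "g \<in> carrier ?G" using assms by (auto simp: Hom_group_def Hom_def)
  from m_closed[OF this] m_comm[OF this]
  show "f \<oplus> g \<in> Arr C" "Dom C (f \<oplus> g) = Dom C g" "Cod C (f \<oplus> g) = Cod C g" "f \<oplus> g = g \<oplus> f"
    by (auto simp: Hom_group_def Hom_def)
qed

lemma Add_assoc:
  assumes "f \<in> Arr C" "g \<in> Arr C" "h \<in> Arr C" "Dom C f = Dom C g" "Cod C f = Cod C g"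
    "Dom C g = Dom C h" "Cod C g = Cod C h"
  shows "(f \<oplus> g) \<oplus> h = f \<oplus> (g \<oplus> h)"
proof -
  let ?G = "Hom_group C (Dom C h) (Cod C h)"
  interpret comm_group ?G
    using assms by (auto intro!: Hom_comm_group Dom_closed Cod_closed)
  have "f \<in> carrier ?G" "g \<in> carrier ?G" "h \<in> carrier ?G"
    using assms by (auto simp: Hom_group_def Hom_def)
  from m_assoc[OF this] show ?thesis by (auto simp: Hom_group_def)
qed

lemma
  assumes "f \<in> Arr C"
  shows Add_Zero [simp]: "Dom C f = X \<Longrightarrow> Cod C f = Y \<Longrightarrow> f \<oplus> Zero C X Y = f"
    "Dom C f = X \<Longrightarrow> Cod C f = Y \<Longrightarrow> Zero C X Y \<oplus> f = f"
    and neg_simps [simp]: "neg f \<in> Arr C" "Dom C (neg f) = Dom C f" "Cod C (neg f) = Cod C f"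
    and Add_neg [simp]: "f \<oplus> neg f = Zero C (Dom C f) (Cod C f)"
    "neg f \<oplus> f = Zero C (Dom C f) (Cod C f)"
proof -
  let ?G = "Hom_group C (Dom C f) (Cod C f)"
  interpret comm_group ?G
    using assms by (auto intro!: Hom_comm_group Dom_closed Cod_closed)
  have f: "f \<in> carrier ?G" using assms by (auto simp: Hom_group_def Hom_def)
  show "Dom C f = X \<Longrightarrow> Cod C f = Y \<Longrightarrow> f \<oplus> Zero C X Y = f"
    "Dom C f = X \<Longrightarrow> Cod C f = Y \<Longrightarrow> Zero C X Y \<oplus> f = f"
    using r_one[OF f] l_one[OF f] by (auto simp: Hom_group_def)
  show "neg f \<in> Arr C" "Dom C (neg f) = Dom C f" "Cod C (neg f) = Cod C f"
    using inv_closed[OF f] unfolding neg_def by (auto simp: Hom_group_def Hom_def)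
  show "f \<oplus> neg f = Zero C (Dom C f) (Cod C f)" "neg f \<oplus> f = Zero C (Dom C f) (Cod C f)"
    using r_inv[OF f] l_inv[OF f] unfolding neg_def by (auto simp: Hom_group_def)
qed

lemma comp_Add [simp]:
  assumes "f \<in> Arr C" "f' \<in> Arr C" "g \<in> Arr C" "Dom C f = Dom C f'"
    "Cod C f = Dom C g" "Cod C f' = Dom C g"
  shows "g \<cdot> (f \<oplus> f') = g \<cdot> f \<oplus> g \<cdot> f'"
  using assms by (intro Comp_Add_right) (auto simp: Hom_def)

lemma Add_comp [simp]:
  assumes "f \<in> Arr C" "g \<in> Arr C" "g' \<in> Arr C" "Cod C g = Cod C g'"
    "Dom C g = Cod C f" "Dom C g' = Cod C f"
  shows "(g \<oplus> g') \<cdot> f = g \<cdot> f \<oplus> g' \<cdot> f"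
  using assms by (intro Comp_Add_left) (auto simp: Hom_def)

lemma Add_left_cancel:
  assumes "f \<oplus> g = f \<oplus> h" "f \<in> Arr C" "g \<in> Arr C" "h \<in> Arr C" "Dom C f = Dom C g"
    "Cod C f = Cod C g" "Dom C h = Dom C g" "Cod C h = Cod C g"
  shows "g = h"
proof -
  have "g = (neg f \<oplus> f) \<oplus> g" using assms(2-) by simp
  also have "\<dots> = neg f \<oplus> (f \<oplus> g)" by (rule Add_assoc) (use assms(2-) in simp_all)
  also have "\<dots> = neg f \<oplus> (f \<oplus> h)" by (simp only: assms(1))
  also have "\<dots> = (neg f \<oplus> f) \<oplus> h" by (rule Add_assoc[symmetric]) (use assms(2-) in simp_all)
  also have "\<dots> = h" using assms(2-) by simp
  finally show ?thesis .
qed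

text \<open>A composite x with a zero arrow satisfies x + x = x + 0 by bilinearity, so cancellation
  gives x = 0.\<close>

lemma comp_Zero [simp]:
  assumes "f \<in> Arr C" "X \<in> Obj C"
  shows "Cod C f = X \<Longrightarrow> Y \<in> Obj C \<Longrightarrow> Zero C X Y \<cdot> f = Zero C (Dom C f) Y"
    and "Dom C f = X \<Longrightarrow> W \<in> Obj C \<Longrightarrow> f \<cdot> Zero C W X = Zero C W (Cod C f)"
proof -
  assume *: "Cod C f = X" "Y \<in> Obj C"
  have o: "Dom C f \<in> Obj C" using assms by (simp add: Dom_closed)
  have "Zero C X Y \<cdot> f \<oplus> Zero C X Y \<cdot> f = (Zero C X Y \<oplus> Zero C X Y) \<cdot> f"
    using assms * by (intro Add_comp[symmetric]) auto
  also have "\<dots> = Zero C X Y \<cdot> f \<oplus> Zero C (Dom C f) Y"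
    using assms * o by (simp del: Add_comp)
  finally have "Zero C X Y \<cdot> f \<oplus> Zero C X Y \<cdot> f = Zero C X Y \<cdot> f \<oplus> Zero C (Dom C f) Y" .
  from Add_left_cancel[OF this] show "Zero C X Y \<cdot> f = Zero C (Dom C f) Y"
    using assms * o by simp
next
  assume *: "Dom C f = X" "W \<in> Obj C"
  have o: "Cod C f \<in> Obj C" using assms by (simp add: Cod_closed)
  have "f \<cdot> Zero C W X \<oplus> f \<cdot> Zero C W X = f \<cdot> (Zero C W X \<oplus> Zero C W X)"
    using assms * by (intro comp_Add[symmetric]) auto
  also have "\<dots> = f \<cdot> Zero C W X \<oplus> Zero C W (Cod C f)"
    using assms * o by (simp del: comp_Add)
  finally have "f \<cdot> Zero C W X \<oplus> f \<cdot> Zero C W X = f \<cdot> Zero C W X \<oplus> Zero C W (Cod C f)" .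
  from Add_left_cancel[OF this] show "f \<cdot> Zero C W X = Zero C W (Cod C f)"
    using assms * o by simp
qed

lemma Add_neg_eq_Zero_iff:
  assumes "f \<in> Arr C" "g \<in> Arr C" "Dom C f = X" "Cod C f = Y" "Dom C g = X" "Cod C g = Y"
  shows "f \<oplus> neg g = Zero C X Y \<longleftrightarrow> f = g"
proof
  assume "f \<oplus> neg g = Zero C X Y"
  then have "neg g \<oplus> f = neg g \<oplus> g" using assms by (simp add: Add_commute)
  from Add_left_cancel[OF this] show "f = g" using assms by simp
qed (use assms in auto)

lemma comp_neg [simp]:
  assumes "f \<in> Arr C" "g \<in> Arr C" "Cod C f = Dom C g"
  shows "g \<cdot> neg f = neg (g \<cdot> f)" "neg g \<cdot> f = neg (g \<cdot> f)"
proof -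
  have o: "Dom C f \<in> Obj C" "Cod C g \<in> Obj C" "Dom C g \<in> Obj C"
    using assms by (auto simp: Dom_closed Cod_closed)
  have "g \<cdot> f \<oplus> g \<cdot> neg f = g \<cdot> (f \<oplus> neg f)"
    using assms by (intro comp_Add[symmetric]) auto
  also have "\<dots> = g \<cdot> f \<oplus> neg (g \<cdot> f)"
    using assms o by (simp del: comp_Add)
  finally have "g \<cdot> f \<oplus> g \<cdot> neg f = g \<cdot> f \<oplus> neg (g \<cdot> f)" .
  from Add_left_cancel[OF this] show "g \<cdot> neg f = neg (g \<cdot> f)" using assms by simp
  have "g \<cdot> f \<oplus> neg g \<cdot> f = (g \<oplus> neg g) \<cdot> f"
    using assms by (intro Add_comp[symmetric]) auto
  also have "\<dots> = g \<cdot> f \<oplus> neg (g \<cdot> f)"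
    using assms o by (simp del: Add_comp)
  finally have "g \<cdot> f \<oplus> neg g \<cdot> f = g \<cdot> f \<oplus> neg (g \<cdot> f)" .
  from Add_left_cancel[OF this] show "neg g \<cdot> f = neg (g \<cdot> f)" using assms by simp
qed

lemma neg_Zero [simp]:
  assumes "X \<in> Obj C" "Y \<in> Obj C"
  shows "neg (Zero C X Y) = Zero C X Y"
  using Add_neg[of "Zero C X Y"] assms by simp

lemma diff_add_cancel [simp]:
  assumes "f \<in> Arr C" "g \<in> Arr C" "Dom C f = Dom C g" "Cod C f = Cod C g"
  shows "(f \<oplus> neg g) \<oplus> g = f" "g \<oplus> (f \<oplus> neg g) = f"
proof -
  have o: "Dom C g \<in> Obj C" "Cod C g \<in> Obj C" using assms by (auto simp: Dom_closed Cod_closed)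
  show "(f \<oplus> neg g) \<oplus> g = f" using assms o by (simp add: Add_assoc)
  then show "g \<oplus> (f \<oplus> neg g) = f" using assms by (simp add: Add_commute)
qed

text \<open>Two arrows with the same composite differ by an arrow that composes to zero, so
  cancellation need only be tested against zero.\<close>

lemma epicI:
  assumes "f \<in> Hom C X Y"
    and "\<And>W h. h \<in> Hom C Y W \<Longrightarrow> h \<cdot> f = Zero C X W \<Longrightarrow> h = Zero C Y W"
  shows "epic C f"
proof -
  have "u = v" if "u \<in> Hom C Y W" "v \<in> Hom C Y W" "u \<cdot> f = v \<cdot> f" for u v W
  proof -
    have "u \<oplus> neg v = Zero C Y W"
      using assms(1) that by (intro assms(2)) (auto simp: Hom_iff)
    then show ?thesis using that by (simp add: Hom_iff Add_neg_eq_Zero_iff)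
  qed
  then show ?thesis using assms(1) unfolding epic_def by (auto simp: Hom_iff)
qed

lemma monicI:
  assumes "f \<in> Hom C X Y"
    and "\<And>W h. h \<in> Hom C W X \<Longrightarrow> f \<cdot> h = Zero C W Y \<Longrightarrow> h = Zero C W X"
  shows "monic C f"
proof -
  have "u = v" if "u \<in> Hom C W X" "v \<in> Hom C W X" "f \<cdot> u = f \<cdot> v" for u v W
  proof -
    have "u \<oplus> neg v = Zero C W X"
      using assms(1) that by (intro assms(2)) (auto simp: Hom_iff)
    then show ?thesis using that by (simp add: Hom_iff Add_neg_eq_Zero_iff)
  qed
  then show ?thesis using assms(1) unfolding monic_def by (auto simp: Hom_iff)
qed

section \<open>Kernels, cokernels and short exact sequences\<close>

text \<open>Keeps the existence half of the universal property; the uniqueness half reappears as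
  \<open>kernel_monic\<close>.\<close>

lemma is_kernelD:
  assumes "is_kernel C k f"
  shows "k \<in> Hom C (Dom C k) (Dom C f)" "f \<in> Hom C (Dom C f) (Cod C f)"
    "f \<cdot> k = Zero C (Dom C k) (Cod C f)" "Cod C k = Dom C f"
    "\<And>W h. h \<in> Hom C W (Dom C f) \<Longrightarrow> f \<cdot> h = Zero C W (Cod C f) \<Longrightarrow>
       \<exists>u. u \<in> Hom C W (Dom C k) \<and> k \<cdot> u = h"
proof -
  have "k \<in> Arr C" "f \<in> Arr C" "Cod C k = Dom C f" "f \<cdot> k = Zero C (Dom C k) (Cod C f)"
    using assms unfolding is_kernel_def by blast+
  then show "k \<in> Hom C (Dom C k) (Dom C f)" "f \<in> Hom C (Dom C f) (Cod C f)"
    "f \<cdot> k = Zero C (Dom C k) (Cod C f)" "Cod C k = Dom C f"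
    by (auto simp: Hom_def)
  show "\<exists>u. u \<in> Hom C W (Dom C k) \<and> k \<cdot> u = h"
    if "h \<in> Hom C W (Dom C f)" "f \<cdot> h = Zero C W (Cod C f)" for W h
    using assms that unfolding is_kernel_def by blast
qed

lemma is_cokernelD:
  assumes "is_cokernel C c f"
  shows "c \<in> Hom C (Cod C f) (Cod C c)" "f \<in> Hom C (Dom C f) (Cod C f)"
    "c \<cdot> f = Zero C (Dom C f) (Cod C c)" "Dom C c = Cod C f"
    "\<And>W h. h \<in> Hom C (Cod C f) W \<Longrightarrow> h \<cdot> f = Zero C (Dom C f) W \<Longrightarrow>
       \<exists>u. u \<in> Hom C (Cod C c) W \<and> u \<cdot> c = h"
proof -
  have "c \<in> Arr C" "f \<in> Arr C" "Dom C c = Cod C f" "c \<cdot> f = Zero C (Dom C f) (Cod C c)"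
    using assms unfolding is_cokernel_def by blast+
  then show "c \<in> Hom C (Cod C f) (Cod C c)" "f \<in> Hom C (Dom C f) (Cod C f)"
    "c \<cdot> f = Zero C (Dom C f) (Cod C c)" "Dom C c = Cod C f"
    by (auto simp: Hom_def)
  show "\<exists>u. u \<in> Hom C (Cod C c) W \<and> u \<cdot> c = h"
    if "h \<in> Hom C (Cod C f) W" "h \<cdot> f = Zero C (Dom C f) W" for W h
    using assms that unfolding is_cokernel_def by blast
qed

lemma kernel_monic: "is_kernel C k f \<Longrightarrow> monic C k"
proof -
  assume k: "is_kernel C k f"
  note k' = is_kernelD[OF k]
  show "monic C k"
  proof (rule monicI[OF k'(1)])
    fix W h assume h: "h \<in> Hom C W (Dom C k)" "k \<cdot> h = Zero C W (Dom C f)"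
    have o: "W \<in> Obj C" "Dom C k \<in> Obj C" "Dom C f \<in> Obj C" "Cod C f \<in> Obj C"
      using h(1) k'(1,2) by (simp_all add: Hom_iff)
    have "\<exists>!u. u \<in> Hom C W (Dom C k) \<and> k \<cdot> u = Zero C W (Dom C f)"
      using k o k'(2) unfolding is_kernel_def by (simp_all add: Hom_iff)
    moreover have "Zero C W (Dom C k) \<in> Hom C W (Dom C k)"
      "k \<cdot> Zero C W (Dom C k) = Zero C W (Dom C f)"
      using o k'(1) by (simp_all add: Hom_iff)
    ultimately show "h = Zero C W (Dom C k)" using h by blast
  qed
qed

lemma cokernel_epic: "is_cokernel C c f \<Longrightarrow> epic C c"
proof -
  assume c: "is_cokernel C c f"
  note c' = is_cokernelD[OF c]
  show "epic C c"
  proof (rule epicI[OF c'(1)])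
    fix W h assume h: "h \<in> Hom C (Cod C c) W" "h \<cdot> c = Zero C (Cod C f) W"
    have o: "W \<in> Obj C" "Cod C c \<in> Obj C" "Dom C f \<in> Obj C" "Cod C f \<in> Obj C"
      using h(1) c'(1,2) by (simp_all add: Hom_iff)
    have "\<exists>!u. u \<in> Hom C (Cod C c) W \<and> u \<cdot> c = Zero C (Cod C f) W"
      using c o c'(2) unfolding is_cokernel_def by (simp_all add: Hom_iff)
    moreover have "Zero C (Cod C c) W \<in> Hom C (Cod C c) W"
      "Zero C (Cod C c) W \<cdot> c = Zero C (Cod C f) W"
      using o c'(1) by (simp_all add: Hom_iff)
    ultimately show "h = Zero C (Cod C c) W" using h by blast
  qed
qed

lemma is_kernelI:
  assumes "monic C k" "k \<in> Hom C K N" "f \<in> Hom C N L" "f \<cdot> k = Zero C K L"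
    and "\<And>W h. h \<in> Hom C W N \<Longrightarrow> f \<cdot> h = Zero C W L \<Longrightarrow> \<exists>u. u \<in> Hom C W K \<and> k \<cdot> u = h"
  shows "is_kernel C k f"
proof -
  have "\<exists>!u. u \<in> Hom C W K \<and> k \<cdot> u = h" if h: "h \<in> Hom C W N" "f \<cdot> h = Zero C W L" for W h
  proof -
    obtain u where "u \<in> Hom C W K" "k \<cdot> u = h" using assms(5)[OF h] by blast
    moreover have "u' = u" if "u' \<in> Hom C W K" "k \<cdot> u' = h" for u'
      by (rule monicD[OF assms(1)]) (use that calculation assms(2) in \<open>simp_all add: Hom_iff\<close>)
    ultimately show ?thesis by blast
  qed
  note uniq = this
  have e: "Dom C k = K" "Cod C k = N" "Dom C f = N" "Cod C f = L" and a: "k \<in> Arr C" "f \<in> Arr C"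
    using assms(2,3) by (simp_all add: Hom_iff)
  show ?thesis unfolding is_kernel_def e
    by (intro conjI allI ballI impI refl a assms(4)) (rule uniq)
qed

lemma is_cokernelI:
  assumes "epic C c" "f \<in> Hom C K N" "c \<in> Hom C N L" "c \<cdot> f = Zero C K L"
    and "\<And>W h. h \<in> Hom C N W \<Longrightarrow> h \<cdot> f = Zero C K W \<Longrightarrow> \<exists>u. u \<in> Hom C L W \<and> u \<cdot> c = h"
  shows "is_cokernel C c f"
proof -
  have "\<exists>!u. u \<in> Hom C L W \<and> u \<cdot> c = h" if h: "h \<in> Hom C N W" "h \<cdot> f = Zero C K W" for W h
  proof -
    obtain u where "u \<in> Hom C L W" "u \<cdot> c = h" using assms(5)[OF h] by blast
    moreover have "u' = u" if "u' \<in> Hom C L W" "u' \<cdot> c = h" for u'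
      by (rule epicD[OF assms(1)]) (use that calculation assms(3) in \<open>simp_all add: Hom_iff\<close>)
    ultimately show ?thesis by blast
  qed
  note uniq = this
  have e: "Dom C c = N" "Cod C c = L" "Dom C f = K" "Cod C f = N" and a: "c \<in> Arr C" "f \<in> Arr C"
    using assms(2,3) by (simp_all add: Hom_iff)
  show ?thesis unfolding is_cokernel_def e
    by (intro conjI allI ballI impI refl a assms(4)) (rule uniq)
qed

text \<open>\<open>short_exact\<close> mentions arrows only. With the three objects carried along,
  splicing is expressed by a shared object.\<close>

definition ses :: "'b \<Rightarrow> 'b \<Rightarrow> 'a \<Rightarrow> 'a \<Rightarrow> 'a \<Rightarrow> bool"
  where "ses j q L N K \<longleftrightarrow> short_exact C j q \<and> j \<in> Hom C L N \<and> q \<in> Hom C N K"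

lemma sesD:
  assumes "ses j q L N K"
  shows "j \<in> Hom C L N" "q \<in> Hom C N K" "q \<cdot> j = Zero C L K" "monic C j" "epic C q"
    "is_kernel C j q" "is_cokernel C q j" "short_exact C j q"
proof -
  show *: "j \<in> Hom C L N" "q \<in> Hom C N K" "is_kernel C j q" "is_cokernel C q j" "short_exact C j q"
    using assms unfolding ses_def short_exact_def by blast+
  then show "q \<cdot> j = Zero C L K" "monic C j" "epic C q"
    using is_kernelD(3)[of j q] kernel_monic cokernel_epic by (simp_all add: Hom_iff)
qed

lemma ses_Hom:
  assumes "ses j q L N K"
  shows "j \<in> Arr C" "Dom C j = L" "Cod C j = N" "q \<in> Arr C" "Dom C q = N" "Cod C q = K"
    "L \<in> Obj C" "N \<in> Obj C" "K \<in> Obj C" "q \<cdot> j = Zero C L K"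
  using sesD[OF assms] by (simp_all add: Hom_iff)

lemma ses_lift:
  assumes "ses j q L N K" "h \<in> Hom C W N" "q \<cdot> h = Zero C W K"
  obtains u where "u \<in> Hom C W L" "j \<cdot> u = h"
proof -
  have "\<exists>u. u \<in> Hom C W L \<and> j \<cdot> u = h"
    using is_kernelD(5)[OF sesD(6)[OF assms(1)], of h W] ses_Hom[OF assms(1)] assms by simp
  then show ?thesis using that by blast
qed

lemma ses_factor:
  assumes "ses j q L N K" "h \<in> Hom C N W" "h \<cdot> j = Zero C L W"
  obtains u where "u \<in> Hom C K W" "u \<cdot> q = h"
proof -
  have "\<exists>u. u \<in> Hom C K W \<and> u \<cdot> q = h"
    using is_cokernelD(5)[OF sesD(7)[OF assms(1)], of h W] ses_Hom[OF assms(1)] assms by simp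
  then show ?thesis using that by blast
qed

lemma is_biproductD:
  assumes "is_biproduct C X Y B i j p q"
  shows "i \<in> Arr C" "j \<in> Arr C" "p \<in> Arr C" "q \<in> Arr C" "B \<in> Obj C" "X \<in> Obj C" "Y \<in> Obj C"
    "Dom C i = X" "Dom C j = Y" "Dom C p = B" "Dom C q = B"
    "Cod C i = B" "Cod C j = B" "Cod C p = X" "Cod C q = Y"
    "p \<cdot> i = Ident C X" "q \<cdot> j = Ident C Y" "q \<cdot> i = Zero C X Y" "p \<cdot> j = Zero C Y X"
    "(i \<cdot> p) \<oplus> (j \<cdot> q) = Ident C B"
  using assms unfolding is_biproduct_def by (simp_all add: Hom_iff)

lemma biproduct_decomp_right:
  assumes "is_biproduct C X Y B i j p q" "h \<in> Hom C W B"
  shows "h = i \<cdot> (p \<cdot> h) \<oplus> j \<cdot> (q \<cdot> h)"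
proof -
  note b = is_biproductD[OF assms(1)]
  have "h = ((i \<cdot> p) \<oplus> (j \<cdot> q)) \<cdot> h" using b assms(2) by (simp add: Hom_iff)
  also have "\<dots> = i \<cdot> (p \<cdot> h) \<oplus> j \<cdot> (q \<cdot> h)"
    using b(1-15) assms(2) by (simp add: Hom_iff)
  finally show ?thesis .
qed

lemma biproduct_decomp_left:
  assumes "is_biproduct C X Y B i j p q" "h \<in> Hom C B W"
  shows "h = (h \<cdot> i) \<cdot> p \<oplus> (h \<cdot> j) \<cdot> q"
proof -
  note b = is_biproductD[OF assms(1)]
  have "h = h \<cdot> ((i \<cdot> p) \<oplus> (j \<cdot> q))" using b assms(2) by (simp add: Hom_iff)
  also have "\<dots> = (h \<cdot> i) \<cdot> p \<oplus> (h \<cdot> j) \<cdot> q"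
    using b(1-15) assms(2) by (simp add: Hom_iff)
  finally show ?thesis .
qed

end

section \<open>Short exact sequences, pullbacks and pushouts in an abelian category\<close>

context abelian_category
begin

text \<open>\<open>f\<close> is the kernel of some \<open>g\<close>, and \<open>g\<close> factors
  through the cokernel \<open>c\<close>. So whatever \<open>c\<close> kills is killed by
  \<open>g\<close> and factors through \<open>f\<close>.\<close>

lemma monic_kernel_cokernel:
  assumes "monic C f" "is_cokernel C c f"
  shows "is_kernel C f c"
proof -
  obtain g where g: "is_kernel C f g" using monic_is_kernel[OF assms(1)] by blast
  note g' = is_kernelD[OF g] and c = is_cokernelD[OF assms(2)]
  have "\<exists>u. u \<in> Hom C (Cod C c) (Cod C g) \<and> u \<cdot> c = g"
    using c(5)[of g "Cod C g"] g' by simp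
  then obtain u where u: "u \<in> Hom C (Cod C c) (Cod C g)" "u \<cdot> c = g" by blast
  show ?thesis
  proof (rule is_kernelI[OF assms(1) c(2,1,3)])
    fix W h assume h: "h \<in> Hom C W (Cod C f)" "c \<cdot> h = Zero C W (Cod C c)"
    have "g \<cdot> h = (u \<cdot> c) \<cdot> h" by (simp only: u(2))
    also have "\<dots> = u \<cdot> (c \<cdot> h)" using u(1) h(1) c(1,4) by (simp add: Hom_iff)
    also have "\<dots> = Zero C W (Cod C g)" using u(1) h c(1) by (simp add: Hom_iff)
    finally show "\<exists>u. u \<in> Hom C W (Dom C f) \<and> f \<cdot> u = h"
      using g'(5)[of h W] h g' by simp
  qed
qed

lemma epic_cokernel_kernel:
  assumes "epic C f" "is_kernel C k f"
  shows "is_cokernel C f k"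
proof -
  obtain g where g: "is_cokernel C f g" using epic_is_cokernel[OF assms(1)] by blast
  note g' = is_cokernelD[OF g] and k = is_kernelD[OF assms(2)]
  have "\<exists>u. u \<in> Hom C (Dom C g) (Dom C k) \<and> k \<cdot> u = g"
    using k(5)[of g "Dom C g"] g' by simp
  then obtain u where u: "u \<in> Hom C (Dom C g) (Dom C k)" "k \<cdot> u = g" by blast
  show ?thesis
  proof (rule is_cokernelI[OF assms(1) k(1,2,3)])
    fix W h assume h: "h \<in> Hom C (Dom C f) W" "h \<cdot> k = Zero C (Dom C k) W"
    have "h \<cdot> g = h \<cdot> (k \<cdot> u)" by (simp only: u(2))
    also have "\<dots> = (h \<cdot> k) \<cdot> u" using u(1) h(1) k(1,4) by (simp add: Hom_iff)
    also have "\<dots> = Zero C (Dom C g) W" unfolding h(2) using u(1) h(1) k(1) by (simp add: Hom_iff)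
    finally show "\<exists>u. u \<in> Hom C (Cod C f) W \<and> u \<cdot> f = h"
      using g'(5)[of h W] h g' by simp
  qed
qed

lemma sesI_epic:
  assumes "is_kernel C j q" "epic C q" "j \<in> Hom C L N" "q \<in> Hom C N K"
  shows "ses j q L N K"
  using assms epic_cokernel_kernel unfolding ses_def short_exact_def by blast

lemma sesI_monic:
  assumes "is_cokernel C q j" "monic C j" "j \<in> Hom C L N" "q \<in> Hom C N K"
  shows "ses j q L N K"
  using assms monic_kernel_cokernel unfolding ses_def short_exact_def by blast

lemma epic_ses:
  assumes "epic C q" "q \<in> Hom C N K"
  obtains L j where "ses j q L N K"
proof -
  obtain j where "is_kernel C j q" using assms kernel_exists unfolding epic_def by blast
  moreover from is_kernelD[OF this] have "j \<in> Hom C (Dom C j) N" using assms by (simp add: Hom_iff)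
  ultimately show ?thesis using that sesI_epic assms by blast
qed

lemma monic_ses:
  assumes "monic C j" "j \<in> Hom C L N"
  obtains K q where "ses j q L N K"
proof -
  obtain q where "is_cokernel C q j" using assms cokernel_exists unfolding monic_def by blast
  moreover from is_cokernelD[OF this] have "q \<in> Hom C N (Cod C q)" using assms by (simp add: Hom_iff)
  ultimately show ?thesis using that sesI_monic assms by blast
qed

lemma biproduct_ses:
  assumes "is_biproduct C X Y B i j p q"
  shows "ses i q X B Y"
proof -
  note b = is_biproductD[OF assms]
  have "epic C q"
  proof (rule epicI)
    show "q \<in> Hom C B Y" using b by (simp add: Hom_iff)
    fix W h assume h: "h \<in> Hom C Y W" "h \<cdot> q = Zero C B W"
    have "h = (h \<cdot> q) \<cdot> j" using h(1) b by (simp add: Hom_iff)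
    then show "h = Zero C Y W" using h b by (simp add: Hom_iff)
  qed
  moreover have "monic C i"
  proof (rule monicI)
    show "i \<in> Hom C X B" using b by (simp add: Hom_iff)
    fix W h assume h: "h \<in> Hom C W X" "i \<cdot> h = Zero C W B"
    have "h = p \<cdot> (i \<cdot> h)" using h(1) b by (simp add: Hom_iff reassoc[OF b(16)])
    then show "h = Zero C W X" using h b by (simp add: Hom_iff)
  qed
  moreover have "is_kernel C i q"
  proof (rule is_kernelI[OF calculation(2)])
    fix W h assume h: "h \<in> Hom C W B" "q \<cdot> h = Zero C W Y"
    have "i \<cdot> (p \<cdot> h) = h"
      using biproduct_decomp_right[OF assms h(1)] h b(1-15) by (simp add: Hom_iff)
    then show "\<exists>u. u \<in> Hom C W X \<and> i \<cdot> u = h"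
      using h b by (intro exI[of _ "p \<cdot> h"]) (simp add: Hom_iff)
  qed (use b in \<open>simp_all add: Hom_iff\<close>)
  ultimately show ?thesis using b by (intro sesI_epic) (simp_all add: Hom_iff)
qed

lemma ses_pullback:
  assumes s: "ses j q L N K" and c: "c \<in> Hom C K' K"
  obtains j' q' N' b where "ses j' q' L N' K'" "b \<in> Hom C N' N" "q \<cdot> b = c \<cdot> q'" "b \<cdot> j' = j"
proof -
  have "N \<in> Obj C" "K' \<in> Obj C" using sesD[OF s] c by (simp_all add: Hom_iff)
  then obtain B iN iK pN pK where bp: "is_biproduct C N K' B iN iK pN pK"
    using biproduct_exists by blast
  note b = is_biproductD[OF bp] and s' = ses_Hom[OF s] and c' = c[unfolded Hom_iff]
  \<comment> \<open>\<open>N'\<close> will be the kernel of (q, -c) on the biproduct of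
    \<open>N\<close> and \<open>K'\<close>, the usual fibre product.\<close>
  define d where "d = q \<cdot> pN \<oplus> neg (c \<cdot> pK)"
  have d: "d \<in> Hom C B K" unfolding d_def using b c' s' by (simp add: Hom_iff)
  have diN: "d \<cdot> iN = q" unfolding d_def using b c' s' by simp
  have "epic C d"
  proof (rule epicI[OF d])
    fix W h assume h: "h \<in> Hom C K W" "h \<cdot> d = Zero C B W"
    have "h \<cdot> q = (h \<cdot> d) \<cdot> iN" using h(1) d diN b by (simp add: Hom_iff)
    also have "\<dots> = Zero C K W \<cdot> q" using h d b s' by (simp add: Hom_iff)
    finally show "h = Zero C K W" by (rule epicD[OF sesD(5)[OF s]]) (use h(1) s' in \<open>simp_all add: Hom_iff\<close>)
  qed
  from this d obtain N' m where m: "ses m d N' B K" by (rule epic_ses)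
  note m' = ses_Hom[OF m]
  have eq: "q \<cdot> (pN \<cdot> m) = c \<cdot> (pK \<cdot> m)"
  proof -
    have "q \<cdot> (pN \<cdot> m) \<oplus> neg (c \<cdot> (pK \<cdot> m)) = d \<cdot> m"
      unfolding d_def using b m' s' c' by simp
    then show ?thesis using m'(10) b m' s' c' by (simp add: Add_neg_eq_Zero_iff)
  qed
  have "iN \<cdot> j \<in> Hom C L B" "d \<cdot> (iN \<cdot> j) = Zero C L K"
    using b s' d by (simp_all add: Hom_iff reassoc[OF diN])
  with m obtain j' where j': "j' \<in> Hom C L N'" "m \<cdot> j' = iN \<cdot> j" by (rule ses_lift)
  have pNj: "pN \<cdot> (m \<cdot> j') = j" using b s' by (simp add: j'(2) reassoc[OF b(16)])
  have pKj: "pK \<cdot> (m \<cdot> j') = Zero C L K'" using b s' by (simp add: j'(2) reassoc[OF b(18)])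
  have mono: "monic C j'"
  proof (rule monicI[OF j'(1)])
    fix W h assume h: "h \<in> Hom C W L" "j' \<cdot> h = Zero C W N'"
    have "j \<cdot> h = pN \<cdot> (m \<cdot> (j' \<cdot> h))" using b m' j'(1) h(1) by (simp add: Hom_iff flip: pNj)
    also have "\<dots> = j \<cdot> Zero C W L" using b m' j'(1) h s' by (simp add: Hom_iff)
    finally show "h = Zero C W L" by (rule monicD[OF sesD(4)[OF s]]) (use h(1) s' in \<open>simp_all add: Hom_iff\<close>)
  qed
  have ker: "is_kernel C j' (pK \<cdot> m)"
  proof (rule is_kernelI[OF mono j'(1)])
    show "pK \<cdot> m \<in> Hom C N' K'" "(pK \<cdot> m) \<cdot> j' = Zero C L K'"
      using b m' j'(1) pKj by (simp_all add: Hom_iff)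
    fix W h assume h: "h \<in> Hom C W N'" "(pK \<cdot> m) \<cdot> h = Zero C W K'"
    then have h': "h \<in> Arr C" "Dom C h = W" "Cod C h = N'" "W \<in> Obj C" "pK \<cdot> (m \<cdot> h) = Zero C W K'"
      using b m' by (simp_all add: Hom_iff)
    have "q \<cdot> (pN \<cdot> (m \<cdot> h)) = c \<cdot> (pK \<cdot> (m \<cdot> h))"
      using reassoc[OF eq, of h] b m' s' c' h'(1-4) by simp
    then have "q \<cdot> (pN \<cdot> (m \<cdot> h)) = Zero C W K" using h' c' b by simp
    moreover have "pN \<cdot> (m \<cdot> h) \<in> Hom C W N" using b m' h' by (simp add: Hom_iff)
    ultimately obtain u where u: "u \<in> Hom C W L" "j \<cdot> u = pN \<cdot> (m \<cdot> h)" using ses_lift[OF s] by blast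
    have "m \<cdot> h = iN \<cdot> (pN \<cdot> (m \<cdot> h))"
      using biproduct_decomp_right[OF bp, of "m \<cdot> h" W] b(1-15) m' h' by (simp add: Hom_iff)
    also have "\<dots> = m \<cdot> (j' \<cdot> u)"
      using reassoc[OF j'(2), of u] u b(1-15) m' j'(1) s' by (simp add: Hom_iff)
    finally have "m \<cdot> (j' \<cdot> u) = m \<cdot> h" by (rule sym)
    then have "j' \<cdot> u = h"
      by (rule monicD[OF sesD(4)[OF m]]) (use u m' j'(1) h' in \<open>simp_all add: Hom_iff\<close>)
    then show "\<exists>u. u \<in> Hom C W L \<and> j' \<cdot> u = h" using u by blast
  qed
  \<comment> \<open>Stability of epimorphisms under pullback: \<open>d\<close> is the cokernel of
    \<open>m\<close>, so if \<open>h \<cdot> pK \<cdot> m\<close> is zero, then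
    \<open>h \<cdot> pK\<close> comes from an arrow \<open>y\<close> on \<open>K\<close>, and
    restricting to \<open>N\<close> forces y = 0.\<close>
  have epi: "epic C (pK \<cdot> m)"
  proof (rule epicI)
    show "pK \<cdot> m \<in> Hom C N' K'" using b m' by (simp_all add: Hom_iff)
    fix W h assume h: "h \<in> Hom C K' W" "h \<cdot> (pK \<cdot> m) = Zero C N' W"
    then have "h \<cdot> pK \<in> Hom C B W" "(h \<cdot> pK) \<cdot> m = Zero C N' W" using b m' by (simp_all add: Hom_iff)
    with m obtain y where y: "y \<in> Hom C K W" "y \<cdot> d = h \<cdot> pK" by (rule ses_factor)
    have "y \<cdot> q = (y \<cdot> d) \<cdot> iN" using y(1) d diN b by (simp add: Hom_iff)
    also have "\<dots> = Zero C K W \<cdot> q" using y h(1) b s' by (simp add: Hom_iff)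
    finally have y0: "y = Zero C K W"
      by (rule epicD[OF sesD(5)[OF s]]) (use y(1) s' in \<open>simp_all add: Hom_iff\<close>)
    have "h = (h \<cdot> pK) \<cdot> iK" using h(1) b by (simp add: Hom_iff)
    also have "\<dots> = (y \<cdot> d) \<cdot> iK" by (simp only: y(2))
    also have "\<dots> = Zero C K' W" unfolding y0 using y(1) d b by (simp add: Hom_iff)
    finally show "h = Zero C K' W" .
  qed
  have "ses j' (pK \<cdot> m) L N' K'"
    by (rule sesI_epic[OF ker epi]) (use j'(1) b m' in \<open>simp_all add: Hom_iff\<close>)
  moreover have "pN \<cdot> m \<in> Hom C N' N" "q \<cdot> (pN \<cdot> m) = c \<cdot> (pK \<cdot> m)" "(pN \<cdot> m) \<cdot> j' = j"
    using eq b m' pNj j'(1) by (simp_all add: Hom_iff)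
  ultimately show ?thesis using that by blast
qed

lemma ses_pushout:
  assumes s: "ses j q L N K" and c: "c \<in> Hom C L L'"
  obtains j' q' N' b where "ses j' q' L' N' K" "b \<in> Hom C N N'" "b \<cdot> j = j' \<cdot> c" "q' \<cdot> b = q"
proof -
  have "N \<in> Obj C" "L' \<in> Obj C" using sesD[OF s] c by (simp_all add: Hom_iff)
  then obtain B iN iL pN pL where bp: "is_biproduct C N L' B iN iL pN pL"
    using biproduct_exists by blast
  note b = is_biproductD[OF bp] and s' = ses_Hom[OF s] and c' = c[unfolded Hom_iff]
  \<comment> \<open>Dually, \<open>N'\<close> will be the cokernel of (j, -c) into the biproduct of
    \<open>N\<close> and \<open>L'\<close>.\<close>
  define d where "d = iN \<cdot> j \<oplus> neg (iL \<cdot> c)"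
  have d: "d \<in> Hom C L B" unfolding d_def using b c' s' by (simp add: Hom_iff)
  have pNd: "pN \<cdot> d = j" unfolding d_def using b c' s'
    by (simp add: reassoc[OF b(16)] reassoc[OF b(19)])
  have "monic C d"
  proof (rule monicI[OF d])
    fix W h assume h: "h \<in> Hom C W L" "d \<cdot> h = Zero C W B"
    have "j \<cdot> h = pN \<cdot> (d \<cdot> h)" using h(1) d b by (simp add: Hom_iff reassoc[OF pNd])
    also have "\<dots> = j \<cdot> Zero C W L" using h d b s' by (simp add: Hom_iff)
    finally show "h = Zero C W L" by (rule monicD[OF sesD(4)[OF s]]) (use h(1) s' in \<open>simp_all add: Hom_iff\<close>)
  qed
  from this d obtain N' m where m: "ses d m L B N'" by (rule monic_ses)
  note m' = ses_Hom[OF m]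
  have eq: "m \<cdot> (iN \<cdot> j) = m \<cdot> (iL \<cdot> c)"
  proof -
    have "m \<cdot> (iN \<cdot> j) \<oplus> neg (m \<cdot> (iL \<cdot> c)) = m \<cdot> d"
      unfolding d_def using b m' s' c' by simp
    then show ?thesis using m'(10) b m' s' c' by (simp add: Add_neg_eq_Zero_iff)
  qed
  have qpd: "q \<cdot> pN \<in> Hom C B K" "(q \<cdot> pN) \<cdot> d = Zero C L K"
    using b s' d by (simp_all add: Hom_iff pNd)
  with m obtain q' where q': "q' \<in> Hom C N' K" "q' \<cdot> m = q \<cdot> pN" by (rule ses_factor)
  have qiN: "q' \<cdot> (m \<cdot> iN) = q" using b s' m' q'(1) by (simp add: reassoc[OF q'(2)] Hom_iff)
  have qiL: "q' \<cdot> (m \<cdot> iL) = Zero C L' K" using b s' m' q'(1) by (simp add: reassoc[OF q'(2)] Hom_iff)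
  have epi: "epic C q'"
  proof (rule epicI[OF q'(1)])
    fix W h assume h: "h \<in> Hom C K W" "h \<cdot> q' = Zero C N' W"
    have "h \<cdot> q = (h \<cdot> q') \<cdot> (m \<cdot> iN)" using b m' q'(1) h(1) by (simp add: Hom_iff flip: qiN)
    also have "\<dots> = Zero C K W \<cdot> q" using b m' q'(1) h s' by (simp add: Hom_iff)
    finally show "h = Zero C K W" by (rule epicD[OF sesD(5)[OF s]]) (use h(1) s' in \<open>simp_all add: Hom_iff\<close>)
  qed
  have miL: "m \<cdot> iL \<in> Hom C L' N'" using b m' by (simp_all add: Hom_iff)
  have coker: "is_cokernel C q' (m \<cdot> iL)"
  proof (rule is_cokernelI[OF epi miL q'(1) qiL])
    fix W h assume h: "h \<in> Hom C N' W" "h \<cdot> (m \<cdot> iL) = Zero C L' W"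
    then have h': "h \<in> Arr C" "Dom C h = N'" "Cod C h = W" "W \<in> Obj C" by (simp_all add: Hom_iff)
    have "((h \<cdot> m) \<cdot> iN) \<cdot> j = (h \<cdot> (m \<cdot> iL)) \<cdot> c" using b m' s' c' h' eq by simp
    then have "((h \<cdot> m) \<cdot> iN) \<cdot> j = Zero C L W" unfolding h(2) using c' h' by simp
    moreover have "(h \<cdot> m) \<cdot> iN \<in> Hom C N W" using b m' h' by (simp add: Hom_iff)
    ultimately obtain u where u: "u \<in> Hom C K W" "u \<cdot> q = (h \<cdot> m) \<cdot> iN" using ses_factor[OF s] by blast
    have "h \<cdot> m = ((h \<cdot> m) \<cdot> iN) \<cdot> pN \<oplus> ((h \<cdot> m) \<cdot> iL) \<cdot> pL"
      by (rule biproduct_decomp_left[OF bp]) (use b m' h' in \<open>simp add: Hom_iff\<close>)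
    also have "(h \<cdot> m) \<cdot> iL = Zero C L' W" using h(2) b m' h' by simp
    also have "((h \<cdot> m) \<cdot> iN) \<cdot> pN \<oplus> Zero C L' W \<cdot> pL = (u \<cdot> q) \<cdot> pN"
      unfolding u(2) using b(1-15) m' h' by simp
    also have "\<dots> = (u \<cdot> q') \<cdot> m"
      using u(1) b(1-15) m' s' q' by (simp add: Hom_iff)
    finally have "(u \<cdot> q') \<cdot> m = h \<cdot> m" by (rule sym)
    then have "u \<cdot> q' = h"
      by (rule epicD[OF sesD(5)[OF m]]) (use u m' q'(1) h' in \<open>simp_all add: Hom_iff\<close>)
    then show "\<exists>u. u \<in> Hom C K W \<and> u \<cdot> q' = h" using u by blast
  qed
  \<comment> \<open>If \<open>iL \<cdot> h\<close> dies in the cokernel of \<open>d\<close>, it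
    equals some \<open>d \<cdot> y\<close>; its component \<open>j \<cdot> y\<close> in
    \<open>N\<close> vanishes, so y = 0.\<close>
  have mono: "monic C (m \<cdot> iL)"
  proof (rule monicI[OF miL])
    fix W h assume h: "h \<in> Hom C W L'" "(m \<cdot> iL) \<cdot> h = Zero C W N'"
    then have "iL \<cdot> h \<in> Hom C W B" "m \<cdot> (iL \<cdot> h) = Zero C W N'" using b m' by (simp_all add: Hom_iff)
    with m obtain y where y: "y \<in> Hom C W L" "d \<cdot> y = iL \<cdot> h" by (rule ses_lift)
    have "j \<cdot> y = pN \<cdot> (d \<cdot> y)" using y(1) d b by (simp add: Hom_iff reassoc[OF pNd])
    also have "\<dots> = j \<cdot> Zero C W L" using y(2) h(1) b s' y(1) by (simp add: Hom_iff reassoc[OF b(19)])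
    finally have y0: "y = Zero C W L"
      by (rule monicD[OF sesD(4)[OF s]]) (use y(1) s' in \<open>simp_all add: Hom_iff\<close>)
    have "h = pL \<cdot> (iL \<cdot> h)" using h(1) b by (simp add: Hom_iff reassoc[OF b(17)])
    also have "\<dots> = pL \<cdot> (d \<cdot> y)" by (simp only: y(2))
    also have "\<dots> = Zero C W L'" unfolding y0 using y(1) d b by (simp add: Hom_iff)
    finally show "h = Zero C W L'" .
  qed
  have "ses (m \<cdot> iL) q' L' N' K" by (rule sesI_monic[OF coker mono miL q'(1)])
  moreover have "m \<cdot> iN \<in> Hom C N N'" "(m \<cdot> iN) \<cdot> j = (m \<cdot> iL) \<cdot> c" "q' \<cdot> (m \<cdot> iN) = q"
    using eq b m' qiN s' c' by (simp_all add: Hom_iff)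
  ultimately show ?thesis using that by blast
qed

section \<open>Resolutions and effaceable classes\<close>

text \<open>
  A resolution of length \<open>n\<close> of \<open>T\<close> is an exact sequence
  \<open>0 \<rightarrow> K \<rightarrow> N\<^sub>n \<rightarrow> \<dots> \<rightarrow> N\<^sub>1 \<rightarrow> T \<rightarrow> 0\<close>, stored as the list of its short exact pieces
  with the piece starting at \<open>K\<close> first.
\<close>

inductive resolution :: "'a \<Rightarrow> ('b \<times> 'b) list \<Rightarrow> 'a \<Rightarrow> bool" for T
  where
    Nil: "T \<in> Obj C \<Longrightarrow> resolution T [] T"
  | Cons: "resolution T r K \<Longrightarrow> ses j q L N K \<Longrightarrow> resolution T ((j, q) # r) L"

text \<open>A map of resolutions over the identity of \<open>T\<close>. The middle components
  \<open>b\<close> are forgotten; the component on the left ends stays as an index, since the arrows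
  to be extended are composed with it.\<close>

inductive refines :: "'a \<Rightarrow> ('b \<times> 'b) list \<Rightarrow> 'a \<Rightarrow> ('b \<times> 'b) list \<Rightarrow> 'a \<Rightarrow> 'b \<Rightarrow> bool" for T
  where
    Nil: "T \<in> Obj C \<Longrightarrow> refines T [] T [] T (Ident C T)"
  | Cons: "\<lbrakk>refines T r' K' r K c; ses j' q' L' N' K'; ses j q L N K;
      b \<in> Hom C N' N; c' \<in> Hom C L' L; q \<cdot> b = c \<cdot> q'; j \<cdot> c' = b \<cdot> j'\<rbrakk>
      \<Longrightarrow> refines T ((j', q') # r') L' ((j, q) # r) L c'"

lemma resolution_ConsE:
  assumes "resolution T ((j, q) # r) L"
  obtains N K where "resolution T r K" "ses j q L N K"
  using assms by cases auto

lemma resolution_Obj: "resolution T r K \<Longrightarrow> T \<in> Obj C \<and> K \<in> Obj C"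
  by (induction rule: resolution.induct) (auto dest: ses_Hom)

lemma refinesD:
  assumes "refines T r' K' r K c"
  shows "resolution T r' K'" "resolution T r K" "c \<in> Hom C K' K" "length r' = length r"
proof -
  have "resolution T r' K' \<and> resolution T r K \<and> c \<in> Hom C K' K \<and> length r' = length r"
    using assms by (induction rule: refines.induct) (auto intro: resolution.intros simp: Ident_Hom)
  then show "resolution T r' K'" "resolution T r K" "c \<in> Hom C K' K" "length r' = length r"
    by auto
qed

lemma refines_Cons_rightE:
  assumes "refines T r1 L' ((j, q) # r) L c'" "ses j q L N K"
  obtains j' q' r' K' N' b c where "r1 = (j', q') # r'" "refines T r' K' r K c"
    "ses j' q' L' N' K'" "b \<in> Hom C N' N" "c' \<in> Hom C L' L" "q \<cdot> b = c \<cdot> q'" "j \<cdot> c' = b \<cdot> j'"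
  using assms(1)
proof cases
  case (Cons r' K' K0 c j' q' N' N0 b)
  have "N0 = N" "K0 = K" using Cons(4) assms(2) by (auto dest: ses_Hom)
  then show ?thesis using Cons that by blast
qed

lemma refines_refl: "resolution T r K \<Longrightarrow> refines T r K r K (Ident C K)"
proof (induction rule: resolution.induct)
  case (Cons r K j q L N)
  note s = ses_Hom[OF Cons(2)]
  show ?case by (rule refines.Cons[OF Cons(3,2,2), of "Ident C N"]) (use s in \<open>simp_all add: Hom_iff\<close>)
qed (rule refines.Nil)

lemma refines_trans:
  assumes "refines T r' K' r K c" "refines T r'' K'' r' K' d"
  shows "refines T r'' K'' r K (c \<cdot> d)"
  using assms
proof (induction arbitrary: r'' K'' d rule: refines.induct)
  case Nil
  from Nil(2) show ?case by cases (use Nil in \<open>auto intro: refines.Nil\<close>)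
next
  case (Cons r' K' r K c j' q' L' N' j q L N b c')
  from Cons.prems Cons(2) obtain j2 q2 r2 K2 N2 b2 c2 where
    r'': "r'' = (j2, q2) # r2" and r2: "refines T r2 K2 r' K' c2" and s2: "ses j2 q2 K'' N2 K2"
    and b2: "b2 \<in> Hom C N2 N'" "d \<in> Hom C K'' L'" "q' \<cdot> b2 = c2 \<cdot> q2" "j' \<cdot> d = b2 \<cdot> j2"
    by (rule refines_Cons_rightE)
  note s = ses_Hom[OF Cons(2)] ses_Hom[OF Cons(3)] ses_Hom[OF s2]
    and h = b2(1,2)[unfolded Hom_iff] Cons(4,5)[unfolded Hom_iff]
      refinesD(3)[OF Cons(1), unfolded Hom_iff] refinesD(3)[OF r2, unfolded Hom_iff]
  have "q \<cdot> (b \<cdot> b2) = (c \<cdot> c2) \<cdot> q2" "j \<cdot> (c' \<cdot> d) = (b \<cdot> b2) \<cdot> j2"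
    using s h by (simp_all add: reassoc[OF Cons(6)] reassoc[OF Cons(7)] b2(3,4))
  moreover have "b \<cdot> b2 \<in> Hom C N2 N" "c' \<cdot> d \<in> Hom C K'' L" using h by (simp_all add: Hom_iff)
  ultimately show ?case unfolding r'' using refines.Cons[OF Cons(8)[OF r2] s2 Cons(3)] by blast
qed

text \<open>A refinement of the tail extends to one more piece by pulling that piece back. A
  pullback keeps the kernel, so the left end does not change.\<close>

lemma refines_lift:
  assumes "refines T r' K' r K c" "ses j q L N K"
  obtains j' q' N' b where "ses j' q' L N' K'" "b \<in> Hom C N' N" "q \<cdot> b = c \<cdot> q'" "b \<cdot> j' = j"
    "refines T ((j', q') # r') L ((j, q) # r) L (Ident C L)"
proof -
  obtain j' q' N' b where *: "ses j' q' L N' K'" "b \<in> Hom C N' N" "q \<cdot> b = c \<cdot> q'" "b \<cdot> j' = j"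
    by (rule ses_pullback[OF assms(2) refinesD(3)[OF assms(1)]])
  have "Ident C L \<in> Hom C L L" "j \<cdot> Ident C L = b \<cdot> j'"
    using ses_Hom[OF assms(2)] *(4) by (simp_all add: Hom_iff)
  from refines.Cons[OF assms(1) *(1) assms(2) *(2) this(1) *(3) this(2)] show ?thesis
    by (rule that[OF *])
qed

text \<open>Substitute for projectivity of \<open>N\<close>: the arrow \<open>h\<close> lifts along
  the epimorphism \<open>g\<close> once \<open>N\<close> is replaced by a pullback. The new piece
  still ends at \<open>K\<close>; its kernel \<open>L'\<close> is new.\<close>

lemma refines_cover:
  assumes "resolution T r K" "ses j q L N K" "ses a g A B D" "h \<in> Hom C N D"
  obtains j' q' L' N' b c h' where "ses j' q' L' N' K" "b \<in> Hom C N' N" "q \<cdot> b = q'"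
    "j \<cdot> c = b \<cdot> j'" "h' \<in> Hom C N' B" "g \<cdot> h' = h \<cdot> b"
    "refines T ((j', q') # r) L' ((j, q) # r) L c"
proof -
  obtain a' p N' h' where p: "ses a' p A N' N" "h' \<in> Hom C N' B" "g \<cdot> h' = h \<cdot> p" "h' \<cdot> a' = a"
    by (rule ses_pullback[OF assms(3,4)])
  note s = ses_Hom[OF assms(2)] ses_Hom[OF p(1)]
  have "epic C (q \<cdot> p)" "q \<cdot> p \<in> Hom C N' K"
    using s epic_comp[OF sesD(5)[OF p(1)] sesD(5)[OF assms(2)]] by (simp_all add: Hom_iff)
  then obtain j' L' where j': "ses j' (q \<cdot> p) L' N' K" by (rule epic_ses)
  note s' = ses_Hom[OF j']
  have "p \<cdot> j' \<in> Hom C L' N" "q \<cdot> (p \<cdot> j') = Zero C L' K" using s s' by (simp_all add: Hom_iff)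
  with assms(2) obtain c where c: "c \<in> Hom C L' L" "j \<cdot> c = p \<cdot> j'" by (rule ses_lift)
  have "p \<in> Hom C N' N" "q \<cdot> p = Ident C K \<cdot> (q \<cdot> p)" using s by (simp_all add: Hom_iff)
  from refines.Cons[OF refines_refl[OF assms(1)] j' assms(2) this(1) c(1) this(2) c(2)]
  show ?thesis by (rule that[OF j' \<open>p \<in> Hom C N' N\<close> refl c(2) p(2,3)])
qed

text \<open>
  The pair \<open>(r, f)\<close> represents a class in \<open>Ext\<^sup>n(T, X)\<close>, namely the pushout of \<open>r\<close>
  along \<open>f\<close>; the class is zero when \<open>f\<close> extends over the first term of some refinement of \<open>r\<close>.
\<close>

definition effaced :: "'a \<Rightarrow> ('b \<times> 'b) list \<Rightarrow> 'a \<Rightarrow> 'a \<Rightarrow> 'b \<Rightarrow> bool"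
  where "effaced T r K X f \<longleftrightarrow> (\<exists>j' q' r' L' c g.
    refines T ((j', q') # r') L' r K c \<and> g \<in> Hom C (Cod C j') X \<and> g \<cdot> j' = f \<cdot> c)"

text \<open>Stands for the vanishing of Ext of degree \<open>n\<close>. Quantifying over all arrows
  \<open>f\<close>, not just identities, saves pushouts in the chases. It is meant for n \<ge> 1,
  since \<open>[]\<close> has no refinement with a first piece.\<close>

definition effaceable :: "'a \<Rightarrow> nat \<Rightarrow> 'a \<Rightarrow> bool"
  where "effaceable T n X \<longleftrightarrow>
    (\<forall>r K. \<forall>f \<in> Hom C K X. resolution T r K \<longrightarrow> length r = n \<longrightarrow> effaced T r K X f)"

lemma effacedI:
  assumes "refines T ((j', q') # r') L' r K c" "ses j' q' L' N' K'" "g \<in> Hom C N' X" "g \<cdot> j' = f \<cdot> c"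
  shows "effaced T r K X f"
  using assms ses_Hom(3)[OF assms(2)] unfolding effaced_def by blast

lemma effacedE:
  assumes "effaced T ((j, q) # r) L X f" "ses j q L N K"
  obtains j' q' r' K' L' N' b c d g where "refines T r' K' r K d"
    "ses j' q' L' N' K'" "b \<in> Hom C N' N" "c \<in> Hom C L' L" "q \<cdot> b = d \<cdot> q'" "j \<cdot> c = b \<cdot> j'"
    "refines T ((j', q') # r') L' ((j, q) # r) L c" "g \<in> Hom C N' X" "g \<cdot> j' = f \<cdot> c"
proof -
  obtain j' q' r' L' c g where *: "refines T ((j', q') # r') L' ((j, q) # r) L c"
      "g \<in> Hom C (Cod C j') X" "g \<cdot> j' = f \<cdot> c"
    using assms(1) unfolding effaced_def by blast
  from *(1) assms(2) show ?thesis
  proof (rule refines_Cons_rightE)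
    fix j2 q2 r2 K2 N2 b2 c2
    assume **: "(j', q') # r' = (j2, q2) # r2" "refines T r2 K2 r K c2"
      "ses j2 q2 L' N2 K2" "b2 \<in> Hom C N2 N" "c \<in> Hom C L' L" "q \<cdot> b2 = c2 \<cdot> q2" "j \<cdot> c = b2 \<cdot> j2"
    show ?thesis using that[of r2 K2 c2 j2 q2 L' N2 b2 c g] * ** ses_Hom(3)[OF **(3)] by simp
  qed
qed

section \<open>Vanishing along short exact sequences and retracts\<close>

lemma effaceableD:
  assumes "effaceable T n X" "resolution T r K" "length r = n" "f \<in> Hom C K X"
  shows "effaced T r K X f"
  using assms unfolding effaceable_def by blast

lemma resolution_posE:
  assumes "resolution T r L" "length r > 0"
  obtains j q r' N K where "r = (j, q) # r'" "resolution T r' K" "ses j q L N K"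
  using assms by cases auto

text \<open>Spliced with the pullback of the sequence along \<open>f\<close>, the resolution
  represents the connecting image of the class of \<open>f\<close>. Effacing that makes
  \<open>f\<close> lift to \<open>B\<close> after refinement, and the lift is effaced in
  turn.\<close>

lemma effaceable_quotient:
  assumes s: "ses i g A B D" and n: "n \<ge> 1"
    and B: "effaceable T n B" and A: "effaceable T (Suc n) A"
  shows "effaceable T n D"
  unfolding effaceable_def
proof (intro allI ballI impI)
  fix r K f assume f: "f \<in> Hom C K D" and r: "resolution T r K" "length r = n"
  obtain j q N b where p: "ses j q A N K" "b \<in> Hom C N B" "g \<cdot> b = f \<cdot> q" "b \<cdot> j = i"
    by (rule ses_pullback[OF s f])
  have "Ident C A \<in> Hom C A A" using ses_Hom[OF s] by (simp add: Ident_Hom)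
  from effaceableD[OF A resolution.Cons[OF r(1) p(1)] _ this] r(2)
  have "effaced T ((j, q) # r) A A (Ident C A)" by simp
  then obtain j' q' r' K' L' N' b' c d t where
    r': "refines T r' K' r K d" and s': "ses j' q' L' N' K'"
    and h: "b' \<in> Hom C N' N" "c \<in> Hom C L' A" "t \<in> Hom C N' A"
    and e: "q \<cdot> b' = d \<cdot> q'" "j \<cdot> c = b' \<cdot> j'" "t \<cdot> j' = Ident C A \<cdot> c"
    using p(1) by (rule effacedE)
  note H = ses_Hom[OF s] ses_Hom[OF p(1)] ses_Hom[OF s'] h[unfolded Hom_iff]
    p(2)[unfolded Hom_iff] f[unfolded Hom_iff] refinesD(3)[OF r', unfolded Hom_iff]
  have tj: "t \<cdot> j' = c" using e(3) H by simp
  \<comment> \<open>\<open>b \<cdot> b'\<close> and \<open>i \<cdot> t\<close> agree along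
    \<open>j'\<close>; their difference descends to \<open>K'\<close> and gives the lift
    \<open>u\<close> of \<open>f \<cdot> d\<close>.\<close>
  let ?w = "b \<cdot> b' \<oplus> neg (i \<cdot> t)"
  have w: "?w \<in> Hom C N' B" using H by (simp add: Hom_iff)
  have "b \<cdot> (b' \<cdot> j') = i \<cdot> c" using H by (simp add: reassoc[OF p(4)] flip: e(2))
  then have "?w \<cdot> j' = Zero C L' B" using H by (simp add: tj)
  with s' w obtain u where u: "u \<in> Hom C K' B" "u \<cdot> q' = ?w" by (rule ses_factor)
  have "(g \<cdot> u) \<cdot> q' = (f \<cdot> d) \<cdot> q'"
  proof -
    have "(g \<cdot> u) \<cdot> q' = g \<cdot> ?w" using u H by (simp add: Hom_iff)
    also have "\<dots> = g \<cdot> (b \<cdot> b')" using H by (simp add: reassoc[OF H(10)])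
    also have "\<dots> = (f \<cdot> d) \<cdot> q'" using H by (simp add: reassoc[OF p(3)] e(1))
    finally show ?thesis .
  qed
  then have gu: "g \<cdot> u = f \<cdot> d"
    by (rule epicD[OF sesD(5)[OF s']]) (use u(1) H in \<open>simp_all add: Hom_iff\<close>)
  have "effaced T r' K' B u"
    using effaceableD[OF B refinesD(1)[OF r'] _ u(1)] refinesD(4)[OF r'] r(2) by simp
  then obtain j2 q2 r2 L2 c2 w where
    w: "refines T ((j2, q2) # r2) L2 r' K' c2" "w \<in> Hom C (Cod C j2) B" "w \<cdot> j2 = u \<cdot> c2"
    unfolding effaced_def by blast
  obtain N2 K2 where s2: "ses j2 q2 L2 N2 K2"
    using refinesD(1)[OF w(1)] by (rule resolution_ConsE)
  note H2 = f[unfolded Hom_iff] ses_Hom[OF s] ses_Hom[OF s2] w(2)[unfolded Hom_iff]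
    u(1)[unfolded Hom_iff] refinesD(3)[OF r', unfolded Hom_iff] refinesD(3)[OF w(1), unfolded Hom_iff]
  have "(g \<cdot> w) \<cdot> j2 = f \<cdot> (d \<cdot> c2)" using H2 by (simp add: w(3) reassoc[OF gu])
  moreover have "g \<cdot> w \<in> Hom C N2 D" using H2 by (simp add: Hom_iff)
  ultimately show "effaced T r K D f" using refines_trans[OF r' w(1)] s2 by (intro effacedI)
qed

text \<open>Once the image of the class in \<open>B\<close> is effaced by \<open>t\<close>, the
  composite \<open>g \<cdot> t\<close> descends to a class \<open>u\<close> of degree
  \<open>n\<close> in \<open>D\<close>, up to sign a preimage under the connecting map. Effacing
  \<open>u\<close> provides the correction that moves \<open>t\<close> into
  \<open>A\<close>.\<close>

lemma effaceable_sub: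
  assumes s: "ses i g A B D" and n: "n \<ge> 1"
    and D: "effaceable T n D" and B: "effaceable T (Suc n) B"
  shows "effaceable T (Suc n) A"
  unfolding effaceable_def
proof (intro allI ballI impI)
  fix r L f assume f: "f \<in> Hom C L A" and r: "resolution T r L" "length r = Suc n"
  obtain j q r1 N K where r1: "r = (j, q) # r1" "resolution T r1 K" and sj: "ses j q L N K"
    using r by (auto elim: resolution_posE)
  have "i \<cdot> f \<in> Hom C L B" using f ses_Hom[OF s] by (simp add: Hom_iff)
  from effaceableD[OF B r this] have "effaced T ((j, q) # r1) L B (i \<cdot> f)" using r1 by simp
  then obtain j' q' r' K' L' N' b c d t where
    r': "refines T r' K' r1 K d" and s': "ses j' q' L' N' K'"
    and h: "b \<in> Hom C N' N" "c \<in> Hom C L' L" "t \<in> Hom C N' B"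
    and e: "q \<cdot> b = d \<cdot> q'" "j \<cdot> c = b \<cdot> j'" "t \<cdot> j' = (i \<cdot> f) \<cdot> c"
    and rr: "refines T ((j', q') # r') L' ((j, q) # r1) L c"
    using sj by (rule effacedE)
  note H = ses_Hom[OF s] ses_Hom[OF sj] ses_Hom[OF s'] h[unfolded Hom_iff]
    f[unfolded Hom_iff] refinesD(3)[OF r', unfolded Hom_iff]
  have "g \<cdot> t \<in> Hom C N' D" "(g \<cdot> t) \<cdot> j' = Zero C L' D"
    using H e(3) by (simp_all add: Hom_iff reassoc[OF H(10)])
  with s' obtain u where u: "u \<in> Hom C K' D" "u \<cdot> q' = g \<cdot> t" by (rule ses_factor)
  have len: "length r' = n" using refinesD(4)[OF r'] r(2) r1(1) by simp
  then obtain j1 q1 r2 N1 K1 where r2: "r' = (j1, q1) # r2" and s1: "ses j1 q1 K' N1 K1"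
    using refinesD(1)[OF r'] n by (auto elim: resolution_posE)
  have "effaced T ((j1, q1) # r2) K' D u"
    using effaceableD[OF D refinesD(1)[OF r'] len u(1)] r2 by simp
  then obtain j2 q2 r3 K3 L3 N3 b3 c3 d3 w where
    r3: "refines T r3 K3 r2 K1 d3" and s3: "ses j2 q2 L3 N3 K3"
    and w: "w \<in> Hom C N3 D" "w \<cdot> j2 = u \<cdot> c3"
    and rr3: "refines T ((j2, q2) # r3) L3 ((j1, q1) # r2) K' c3"
    using s1 by (rule effacedE)
  \<comment> \<open>\<open>w\<close> need not lift along \<open>g\<close>, so \<open>N3\<close> is
    enlarged first.\<close>
  obtain j4 q4 L4 N4 b4 c4 w' where s4: "ses j4 q4 L4 N4 K3" and b4: "b4 \<in> Hom C N4 N3"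
    and "q2 \<cdot> b4 = q4" and e4: "j2 \<cdot> c4 = b4 \<cdot> j4" and w': "w' \<in> Hom C N4 B" "g \<cdot> w' = w \<cdot> b4"
    and rr4: "refines T ((j4, q4) # r3) L4 ((j2, q2) # r3) L3 c4"
    by (rule refines_cover[OF refinesD(1)[OF r3] s3 s w(1)])
  have rr5: "refines T ((j4, q4) # r3) L4 r' K' (c3 \<cdot> c4)"
    using refines_trans[OF rr3 rr4] r2 by simp
  \<comment> \<open>The enlarged tail is put back under the first piece without changing
    \<open>L'\<close>, so the arrow to be extended is still \<open>f \<cdot> c\<close>.\<close>
  obtain j5 q5 N5 b5 where s5: "ses j5 q5 L' N5 L4" and b5: "b5 \<in> Hom C N5 N'"
    and e5: "q' \<cdot> b5 = (c3 \<cdot> c4) \<cdot> q5" "b5 \<cdot> j5 = j'"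
    and rr6: "refines T ((j5, q5) # (j4, q4) # r3) L' ((j', q') # r') L' (Ident C L')"
    by (rule refines_lift[OF rr5 s'])
  note H' = H ses_Hom[OF s3] ses_Hom[OF s4] ses_Hom[OF s5] u(1)[unfolded Hom_iff]
    w(1)[unfolded Hom_iff] w'(1)[unfolded Hom_iff] b4[unfolded Hom_iff] b5[unfolded Hom_iff]
    refinesD(3)[OF rr3, unfolded Hom_iff] refinesD(3)[OF rr4, unfolded Hom_iff]
  \<comment> \<open>The correction passes through \<open>q5\<close> and vanishes along
    \<open>j5\<close>: \<open>?v\<close> still restricts to \<open>i \<cdot> (f \<cdot> c)\<close>,
    but \<open>g\<close> now kills it.\<close>
  let ?v = "t \<cdot> b5 \<oplus> neg (w' \<cdot> (j4 \<cdot> q5))"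
  have v: "?v \<in> Hom C N5 B" using H' by (simp add: Hom_iff)
  have "g \<cdot> (w' \<cdot> (j4 \<cdot> q5)) = w \<cdot> (b4 \<cdot> (j4 \<cdot> q5))"
    using H' by (simp add: reassoc[OF w'(2)])
  also have "\<dots> = w \<cdot> (j2 \<cdot> (c4 \<cdot> q5))" using H' by (simp add: reassoc[OF e4[symmetric]])
  also have "\<dots> = u \<cdot> ((c3 \<cdot> c4) \<cdot> q5)" using H' by (simp add: reassoc[OF w(2)])
  also have "\<dots> = g \<cdot> (t \<cdot> b5)" unfolding e5(1)[symmetric] using H' by (simp add: reassoc[OF u(2)])
  finally have "g \<cdot> ?v = Zero C N5 D" using H' by simp
  with s v obtain x where x: "x \<in> Hom C N5 A" "i \<cdot> x = ?v" by (rule ses_lift)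
  have "i \<cdot> (x \<cdot> j5) = i \<cdot> (f \<cdot> c)"
    using H' x(1) e(3) by (simp add: reassoc[OF x(2)] e5(2) Hom_iff)
  then have "x \<cdot> j5 = f \<cdot> (c \<cdot> Ident C L')"
    using monicD[OF sesD(4)[OF s], of "x \<cdot> j5" "f \<cdot> c"] H' x(1) by (simp add: Hom_iff)
  then show "effaced T r L A f"
    using effacedI[OF _ s5 x(1)] refines_trans[OF rr rr6] r1(1) by blast
qed

text \<open>\<open>u \<cdot> f\<close> and \<open>a \<cdot> f\<close> are effaced one after the
  other, the second on the refinement that serves the first. Both extensions then live on one term
  and are recombined by \<open>v\<close> and \<open>b\<close>.\<close>

lemma effaceable_retract:
  assumes u: "u \<in> Hom C X Y" and v: "v \<in> Hom C Y X" and a: "a \<in> Hom C X P" and b: "b \<in> Hom C P X"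
    and id: "v \<cdot> u \<oplus> b \<cdot> a = Ident C X"
    and Y: "effaceable T n Y" and P: "effaceable T n P"
  shows "effaceable T n X"
  unfolding effaceable_def
proof (intro allI ballI impI)
  fix r K f assume f: "f \<in> Hom C K X" and r: "resolution T r K" "length r = n"
  have "u \<cdot> f \<in> Hom C K Y" using f u by (simp add: Hom_iff)
  from effaceableD[OF Y r this] obtain j1 q1 r1 L1 c1 g1
    where r1: "refines T ((j1, q1) # r1) L1 r K c1"
      and g1: "g1 \<in> Hom C (Cod C j1) Y" "g1 \<cdot> j1 = (u \<cdot> f) \<cdot> c1"
    unfolding effaced_def by blast
  obtain N1 K1 where s1: "ses j1 q1 L1 N1 K1" using refinesD(1)[OF r1] by (rule resolution_ConsE)
  have "a \<cdot> f \<cdot> c1 \<in> Hom C L1 P" using f a refinesD(3)[OF r1] by (simp add: Hom_iff)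
  from effaceableD[OF P refinesD(1)[OF r1] _ this] refinesD(4)[OF r1] r(2)
  have "effaced T ((j1, q1) # r1) L1 P (a \<cdot> f \<cdot> c1)" by simp
  then obtain j2 q2 r2 K2 L2 N2 b2 c2 d2 g2 where
    s2: "ses j2 q2 L2 N2 K2" and b2: "b2 \<in> Hom C N2 N1" "j1 \<cdot> c2 = b2 \<cdot> j2"
    and g2: "g2 \<in> Hom C N2 P" "g2 \<cdot> j2 = (a \<cdot> f \<cdot> c1) \<cdot> c2"
    and r2: "refines T ((j2, q2) # r2) L2 ((j1, q1) # r1) L1 c2"
    using s1 by (rule effacedE)
  note H = ses_Hom[OF s1] ses_Hom[OF s2] f[unfolded Hom_iff] u[unfolded Hom_iff] v[unfolded Hom_iff]
    a[unfolded Hom_iff] b[unfolded Hom_iff] g1(1)[unfolded Hom_iff] g2(1)[unfolded Hom_iff]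
    b2(1)[unfolded Hom_iff] refinesD(3)[OF r1, unfolded Hom_iff] refinesD(3)[OF r2, unfolded Hom_iff]
  let ?g = "v \<cdot> (g1 \<cdot> b2) \<oplus> b \<cdot> g2" and ?c = "c1 \<cdot> c2"
  have g: "?g \<in> Hom C N2 X" using H by (simp add: Hom_iff)
  have "g1 \<cdot> (b2 \<cdot> j2) = u \<cdot> (f \<cdot> ?c)"
    using H by (simp add: reassoc[OF g1(2)] flip: b2(2))
  then have "?g \<cdot> j2 = v \<cdot> (u \<cdot> (f \<cdot> ?c)) \<oplus> b \<cdot> (a \<cdot> (f \<cdot> ?c))" using H g2(2) by simp
  also have "\<dots> = (v \<cdot> u \<oplus> b \<cdot> a) \<cdot> (f \<cdot> ?c)" using H by simp
  also have "\<dots> = f \<cdot> ?c" unfolding id using H by simp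
  finally show "effaced T r K X f" using effacedI[OF refines_trans[OF r1 r2] s2 g] by blast
qed

section \<open>Homotopies, and invariance of effacement under refinement\<close>

lemma refines_homotopy_step:
  assumes s: "ses j q L N K" and s': "ses j' q' L' N' K'" and t: "ses k p M P D"
    and b: "b \<in> Hom C N P" "b' \<in> Hom C N' P" and c: "c \<in> Hom C L M" "c' \<in> Hom C L' M"
    and a: "a \<in> Hom C K D" "a' \<in> Hom C K' D" and e: "p \<cdot> b = a \<cdot> q" "k \<cdot> c = b \<cdot> j"
    and e': "p \<cdot> b' = a' \<cdot> q'" "k \<cdot> c' = b' \<cdot> j'"
    and g: "refines T r0 K0 r K \<gamma>" and d: "refines T r0 K0 r' K' \<delta>"
    and h: "h \<in> Hom C K0 P" "a \<cdot> \<gamma> = a' \<cdot> \<delta> \<oplus> p \<cdot> h"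
  obtains j3 q3 L3 N3 \<gamma>3 \<delta>3 u where "refines T ((j3, q3) # r0) L3 ((j, q) # r) L \<gamma>3"
    "refines T ((j3, q3) # r0) L3 ((j', q') # r') L' \<delta>3" "ses j3 q3 L3 N3 K0"
    "u \<in> Hom C N3 M" "c \<cdot> \<gamma>3 = c' \<cdot> \<delta>3 \<oplus> u \<cdot> j3"
proof -
  \<comment> \<open>Two successive pullbacks give a term \<open>N3\<close> over \<open>K0\<close>
    that maps to both \<open>N\<close> and \<open>N'\<close>.\<close>
  obtain ja qa Na ba where pa: "ses ja qa L Na K0" "ba \<in> Hom C Na N" "q \<cdot> ba = \<gamma> \<cdot> qa" "ba \<cdot> ja = j"
    by (rule ses_pullback[OF s refinesD(3)[OF g]])
  have "\<delta> \<cdot> qa \<in> Hom C Na K'" using refinesD(3)[OF d] ses_Hom[OF pa(1)] by (simp add: Hom_iff)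
  then obtain jb qb N3 bb where pb: "ses jb qb L' N3 Na" "bb \<in> Hom C N3 N'"
      "q' \<cdot> bb = (\<delta> \<cdot> qa) \<cdot> qb" "bb \<cdot> jb = j'"
    by (rule ses_pullback[OF s'])
  note A = ses_Hom[OF s] ses_Hom[OF s'] ses_Hom[OF t] ses_Hom[OF pa(1)] ses_Hom[OF pb(1)]
    b[unfolded Hom_iff] c[unfolded Hom_iff] a[unfolded Hom_iff] pa(2)[unfolded Hom_iff]
    pb(2)[unfolded Hom_iff] h(1)[unfolded Hom_iff] refinesD(3)[OF g, unfolded Hom_iff]
    refinesD(3)[OF d, unfolded Hom_iff]
  define q3 where "q3 = qa \<cdot> qb"
  have "epic C q3" "q3 \<in> Hom C N3 K0" unfolding q3_def
    using A epic_comp[OF sesD(5)[OF pb(1)] sesD(5)[OF pa(1)]] by (simp_all add: Hom_iff)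
  then obtain j3 L3 where s3: "ses j3 q3 L3 N3 K0" by (rule epic_ses)
  note A3 = ses_Hom[OF s3]
  have ba: "ba \<cdot> qb \<in> Hom C N3 N" "q \<cdot> (ba \<cdot> qb) = \<gamma> \<cdot> q3"
    unfolding q3_def using A by (simp_all add: Hom_iff reassoc[OF pa(3)])
  have bb: "q' \<cdot> bb = \<delta> \<cdot> q3" unfolding q3_def using A pb(3) by simp
  define x where "x = ba \<cdot> qb"
  note ba = ba[folded x_def]
  note Ax = ba(1)[unfolded Hom_iff]
  have "x \<cdot> j3 \<in> Hom C L3 N" "q \<cdot> (x \<cdot> j3) = Zero C L3 K"
    using A A3 Ax by (simp_all add: Hom_iff reassoc[OF ba(2)])
  with s obtain \<gamma>3 where \<gamma>3: "\<gamma>3 \<in> Hom C L3 L" "j \<cdot> \<gamma>3 = x \<cdot> j3" by (rule ses_lift)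
  have "bb \<cdot> j3 \<in> Hom C L3 N'" "q' \<cdot> (bb \<cdot> j3) = Zero C L3 K'"
    using A A3 by (simp_all add: Hom_iff reassoc[OF bb])
  with s' obtain \<delta>3 where \<delta>3: "\<delta>3 \<in> Hom C L3 L'" "j' \<cdot> \<delta>3 = bb \<cdot> j3" by (rule ses_lift)
  define w1 where "w1 = b' \<cdot> bb \<oplus> h \<cdot> q3"
  have w1: "w1 \<in> Hom C N3 P" unfolding w1_def using A A3 by (simp add: Hom_iff)
  have "p \<cdot> w1 = (a' \<cdot> \<delta> \<oplus> p \<cdot> h) \<cdot> q3"
    unfolding w1_def using A A3 by (simp add: reassoc[OF e'(1)] bb)
  also have "\<dots> = p \<cdot> (b \<cdot> x)"
    unfolding h(2)[symmetric] using A A3 Ax by (simp add: reassoc[OF e(1)] ba(2))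
  finally have pw: "p \<cdot> w1 = p \<cdot> (b \<cdot> x)" .
  \<comment> \<open>Both maps from \<open>N3\<close> to \<open>P\<close> have the same composite
    with \<open>p\<close>, the old homotopy \<open>h\<close> being built into \<open>w1\<close>. The
    difference therefore lifts to \<open>M\<close>, which is the new homotopy.\<close>
  let ?w = "b \<cdot> x \<oplus> neg w1"
  have "?w \<in> Hom C N3 P" "p \<cdot> ?w = Zero C N3 D"
    using A Ax w1 by (simp_all add: Hom_iff pw)
  with t obtain u where u: "u \<in> Hom C N3 M" "k \<cdot> u = ?w" by (rule ses_lift)
  note A4 = A A3 Ax u(1)[unfolded Hom_iff] w1[unfolded Hom_iff] \<gamma>3(1)[unfolded Hom_iff]
    \<delta>3(1)[unfolded Hom_iff]
  have w1j: "w1 \<cdot> j3 = k \<cdot> (c' \<cdot> \<delta>3)"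
    unfolding w1_def using A4 by (simp add: reassoc[OF e'(2)] \<delta>3(2))
  have "k \<cdot> (c' \<cdot> \<delta>3 \<oplus> u \<cdot> j3) = w1 \<cdot> j3 \<oplus> (k \<cdot> u) \<cdot> j3"
    unfolding w1j using A4 by simp
  also have "\<dots> = (w1 \<oplus> ?w) \<cdot> j3" unfolding u(2) using A4 by simp
  also have "\<dots> = b \<cdot> (x \<cdot> j3)" using A4 by (subst diff_add_cancel(2)) simp_all
  also have "\<dots> = k \<cdot> (c \<cdot> \<gamma>3)" using A4 by (simp add: reassoc[OF e(2)] \<gamma>3(2))
  finally have "k \<cdot> (c \<cdot> \<gamma>3) = k \<cdot> (c' \<cdot> \<delta>3 \<oplus> u \<cdot> j3)" by (rule sym)
  then have eq: "c \<cdot> \<gamma>3 = c' \<cdot> \<delta>3 \<oplus> u \<cdot> j3"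
    by (rule monicD[OF sesD(4)[OF t]]) (use A4 in simp_all)
  show ?thesis
    by (rule that[OF refines.Cons[OF g s3 s ba(1) \<gamma>3(1) ba(2) \<gamma>3(2)]
          refines.Cons[OF d s3 s' pb(2) \<delta>3(1) bb \<delta>3(2)] s3 u(1) eq])
qed

text \<open>Maps of resolutions over \<open>T\<close> with the same target become homotopic after refinement.\<close>

lemma refines_homotopy:
  assumes "refines T r K t D \<alpha>" "refines T r' K' t D \<alpha>'" "r \<noteq> []"
  shows "\<exists>j3 q3 r3 L3 N3 K3 \<gamma> \<delta> u. refines T ((j3, q3) # r3) L3 r K \<gamma> \<and>
    refines T ((j3, q3) # r3) L3 r' K' \<delta> \<and> ses j3 q3 L3 N3 K3 \<and>
    u \<in> Hom C N3 D \<and> \<alpha> \<cdot> \<gamma> = \<alpha>' \<cdot> \<delta> \<oplus> u \<cdot> j3"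
  using assms
proof (induction arbitrary: r' K' \<alpha>' rule: refines.induct)
  case (Cons r K t D a j q L N k p M P b c)
  from Cons.prems(1) Cons(3) obtain j' q' r1' K1' N' b' a' where
    r': "r' = (j', q') # r1'" and r1': "refines T r1' K1' t D a'" and s': "ses j' q' K' N' K1'"
    and h: "b' \<in> Hom C N' P" "\<alpha>' \<in> Hom C K' M" "p \<cdot> b' = a' \<cdot> q'" "k \<cdot> \<alpha>' = b' \<cdot> j'"
    by (rule refines_Cons_rightE)
  note Hh = refinesD(3)[OF Cons(1), unfolded Hom_iff] refinesD(3)[OF r1', unfolded Hom_iff]
    ses_Hom[OF Cons(3)]
  \<comment> \<open>The homotopy of the tails is an arrow to \<open>D\<close>, whereas the step
    lemma needs one to \<open>P\<close>. It is lifted along \<open>p\<close> after enlarging the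
    term on which it lives. For empty tails both maps are the identity of \<open>T\<close>, and the
    zero homotopy serves.\<close>
  obtain r0 K0 g d y where *: "refines T r0 K0 r K g" "refines T r0 K0 r1' K1' d"
    "y \<in> Hom C K0 P" "a \<cdot> g = a' \<cdot> d \<oplus> p \<cdot> y"
  proof (cases "r = []")
    case True
    then have e: "r1' = []" "t = []" using refinesD(4)[OF Cons(1)] refinesD(4)[OF r1'] by auto
    have "K = T" "K1' = T" "D = T" "a = Ident C T" "a' = Ident C T" "T \<in> Obj C"
      using Cons(1) r1' unfolding True e by (auto elim: refines.cases)
    then show ?thesis
      using Hh True e by (intro that[of "[]" T "Ident C T" "Ident C T" "Zero C T P"])
        (auto intro: refines.Nil simp: Hom_iff)
  next
    case False
    then obtain j3 q3 r3 L3 N3 K3 \<gamma> \<delta> u where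
      i: "refines T ((j3, q3) # r3) L3 r K \<gamma>" "refines T ((j3, q3) # r3) L3 r1' K1' \<delta>"
        "ses j3 q3 L3 N3 K3" "u \<in> Hom C N3 D" "a \<cdot> \<gamma> = a' \<cdot> \<delta> \<oplus> u \<cdot> j3"
      using Cons.IH[OF r1'] by blast
    have "resolution T r3 K3"
    proof -
      obtain N0 K0 where "resolution T r3 K0" "ses j3 q3 L3 N0 K0"
        using refinesD(1)[OF i(1)] by (rule resolution_ConsE)
      then show ?thesis using ses_Hom(6)[OF i(3)] ses_Hom(6) by metis
    qed
    then obtain j4 q4 L4 N4 b4 c4 h4 where v: "ses j4 q4 L4 N4 K3" "b4 \<in> Hom C N4 N3"
        "q3 \<cdot> b4 = q4" "j3 \<cdot> c4 = b4 \<cdot> j4" "h4 \<in> Hom C N4 P" "p \<cdot> h4 = u \<cdot> b4"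
        "refines T ((j4, q4) # r3) L4 ((j3, q3) # r3) L3 c4"
      by (rule refines_cover[OF _ i(3) Cons(3) i(4)])
    note A = Hh ses_Hom[OF v(1)] ses_Hom[OF i(3)] v(2,5)[unfolded Hom_iff] i(4)[unfolded Hom_iff]
      refinesD(3)[OF i(1), unfolded Hom_iff] refinesD(3)[OF i(2), unfolded Hom_iff]
      refinesD(3)[OF v(7), unfolded Hom_iff]
    have "a \<cdot> (\<gamma> \<cdot> c4) = (a \<cdot> \<gamma>) \<cdot> c4" using A by simp
    also have "\<dots> = a' \<cdot> (\<delta> \<cdot> c4) \<oplus> u \<cdot> (j3 \<cdot> c4)" unfolding i(5) using A by simp
    also have "u \<cdot> (j3 \<cdot> c4) = p \<cdot> (h4 \<cdot> j4)" unfolding v(4) using A by (simp add: reassoc[OF v(6)])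
    finally show ?thesis
      using A by (intro that[OF refines_trans[OF i(1) v(7)] refines_trans[OF i(2) v(7)], of "h4 \<cdot> j4"])
        (simp_all add: Hom_iff)
  qed
  obtain j3 q3 L3 N3 \<gamma>3 \<delta>3 u where "refines T ((j3, q3) # r0) L3 ((j, q) # r) L \<gamma>3"
    "refines T ((j3, q3) # r0) L3 ((j', q') # r1') K' \<delta>3" "ses j3 q3 L3 N3 K0"
    "u \<in> Hom C N3 M" "c \<cdot> \<gamma>3 = \<alpha>' \<cdot> \<delta>3 \<oplus> u \<cdot> j3"
    by (rule refines_homotopy_step[OF Cons(2) s' Cons(3,4) h(1) Cons(5) h(2)
          refinesD(3)[OF Cons(1)] refinesD(3)[OF r1'] Cons(6,7) h(3,4) *])
  then show ?case unfolding r' by blast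
qed simp

text \<open>From right to left, \<alpha> and the effacing refinement of \<open>t\<close> become
  comparable up to a homotopy \<open>u \<cdot> j3\<close>. This term already extends over
  \<open>N3\<close>, so adding \<open>f \<cdot> u\<close> to the extension absorbs it.\<close>

lemma effaced_refines_iff:
  assumes \<alpha>: "refines T r K t D \<alpha>" and "r \<noteq> []" and f: "f \<in> Hom C D X"
  shows "effaced T r K X (f \<cdot> \<alpha>) \<longleftrightarrow> effaced T t D X f"
proof
  assume "effaced T r K X (f \<cdot> \<alpha>)"
  then obtain j' q' r' L' c g where *: "refines T ((j', q') # r') L' r K c"
      "g \<in> Hom C (Cod C j') X" "g \<cdot> j' = (f \<cdot> \<alpha>) \<cdot> c"
    unfolding effaced_def by blast
  have "g \<cdot> j' = f \<cdot> (\<alpha> \<cdot> c)"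
    using *(3) f refinesD(3)[OF \<alpha>] refinesD(3)[OF *(1)] by (simp add: Hom_iff)
  then show "effaced T t D X f"
    using refines_trans[OF \<alpha> *(1)] *(2) unfolding effaced_def by blast
next
  assume "effaced T t D X f"
  then obtain j' q' r' L' c g where *: "refines T ((j', q') # r') L' t D c"
      "g \<in> Hom C (Cod C j') X" "g \<cdot> j' = f \<cdot> c"
    unfolding effaced_def by blast
  obtain N' K' where s': "ses j' q' L' N' K'" using refinesD(1)[OF *(1)] by (rule resolution_ConsE)
  obtain j3 q3 r3 L3 N3 K3 \<gamma> \<delta> u where
    i: "refines T ((j3, q3) # r3) L3 r K \<gamma>" "refines T ((j3, q3) # r3) L3 ((j', q') # r') L' \<delta>"
      "ses j3 q3 L3 N3 K3" "u \<in> Hom C N3 D" "\<alpha> \<cdot> \<gamma> = c \<cdot> \<delta> \<oplus> u \<cdot> j3"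
    using refines_homotopy[OF \<alpha> *(1) \<open>r \<noteq> []\<close>] by blast
  obtain b where b: "b \<in> Hom C N3 N'" "j' \<cdot> \<delta> = b \<cdot> j3"
  proof -
    from i(2) s' show ?thesis
    proof (rule refines_Cons_rightE)
      fix j2 q2 r2 K2 N2 b2 c2
      assume "(j3, q3) # r3 = (j2, q2) # r2" "ses j2 q2 L3 N2 K2" "b2 \<in> Hom C N2 N'" "j' \<cdot> \<delta> = b2 \<cdot> j2"
      then show ?thesis using that ses_Hom(3)[OF i(3)] ses_Hom(3) by auto
    qed
  qed
  note A = ses_Hom[OF s'] ses_Hom[OF i(3)] b(1)[unfolded Hom_iff] *(2)[unfolded Hom_iff]
    i(4)[unfolded Hom_iff] f[unfolded Hom_iff] refinesD(3)[OF \<alpha>, unfolded Hom_iff]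
    refinesD(3)[OF *(1), unfolded Hom_iff] refinesD(3)[OF i(1), unfolded Hom_iff]
    refinesD(3)[OF i(2), unfolded Hom_iff]
  have g: "g \<cdot> b \<oplus> f \<cdot> u \<in> Hom C N3 X" using A by (simp add: Hom_iff)
  have "(f \<cdot> \<alpha>) \<cdot> \<gamma> = f \<cdot> (c \<cdot> \<delta> \<oplus> u \<cdot> j3)" using A by (simp flip: i(5))
  also have "\<dots> = (g \<cdot> b \<oplus> f \<cdot> u) \<cdot> j3" using A by (simp add: reassoc[OF *(3)[symmetric]] b(2))
  finally show "effaced T r K X (f \<cdot> \<alpha>)" using effacedI[OF i(1,3) g] by simp
qed

section \<open>Yoneda extensions as resolutions\<close>

text \<open>For \<open>p = Ident C K\<close> these are the inner arrows of the extension of \<open>T\<close> by \<open>K\<close> given by \<open>r\<close>.\<close>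

fun arrows :: "'b \<Rightarrow> ('b \<times> 'b) list \<Rightarrow> 'b list"
  where
    "arrows p [] = [p]"
  | "arrows p ((j, q) # r) = (j \<cdot> p) # arrows q r"

lemma length_arrows [simp]: "length (arrows p r) = Suc (length r)"
  by (induction p r rule: arrows.induct) auto

text \<open>Exposes the monomorphism after \<open>p\<close> that \<open>exact_at_splice\<close> asks
  for at the junction with the preceding arrow.\<close>

lemma arrows_0:
  assumes "resolution T r K" "p \<in> Hom C M K"
  obtains m W where "monic C m" "m \<in> Hom C K W" "arrows p r ! 0 = m \<cdot> p"
  using assms(1)
proof cases
  case Nil
  then show ?thesis using that[of "Ident C K" K] assms(2) monic_ident by (simp add: Hom_iff)
next
  case (Cons r' K' j q N)
  then show ?thesis using that[of j N] sesD(1,4)[OF Cons(3)] by simp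
qed

lemma Dom_arrows_0:
  assumes "resolution T r K" "p \<in> Hom C M K"
  shows "Dom C (arrows p r ! 0) = M"
  using arrows_0[OF assms] assms(2) by (metis Comp_Hom Hom_iff)

text \<open>Precomposing with an epimorphism keeps the cokernel and postcomposing with a
  monomorphism keeps the kernel, so \<open>j\<close> is both the image of the first arrow and the
  kernel of the second.\<close>

lemma exact_at_splice:
  assumes "ses j q L N K" "epic C p" "p \<in> Hom C M L" "monic C m" "m \<in> Hom C K W"
  shows "exact_at C (j \<cdot> p) (m \<cdot> q)"
proof -
  note A = ses_Hom[OF assms(1)] assms(3,5)[unfolded Hom_iff]
  have "is_cokernel C q (j \<cdot> p)"
  proof (rule is_cokernelI[OF sesD(5)[OF assms(1)]])
    show "j \<cdot> p \<in> Hom C M N" "q \<in> Hom C N K" "q \<cdot> (j \<cdot> p) = Zero C M K"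
      using A by (simp_all add: Hom_iff reassoc[OF A(10)])
    fix V h assume h: "h \<in> Hom C N V" "h \<cdot> (j \<cdot> p) = Zero C M V"
    have "(h \<cdot> j) \<cdot> p = Zero C L V \<cdot> p" using A h by (simp add: Hom_iff)
    then have "h \<cdot> j = Zero C L V"
      by (rule epicD[OF assms(2)]) (use A h(1) in \<open>simp_all add: Hom_iff\<close>)
    with assms(1) h(1) show "\<exists>u. u \<in> Hom C K V \<and> u \<cdot> q = h" by (metis ses_factor)
  qed
  then have "is_image C j (j \<cdot> p)" using sesD(6)[OF assms(1)] unfolding is_image_def by blast
  moreover have "is_kernel C j (m \<cdot> q)"
  proof (rule is_kernelI[OF sesD(4)[OF assms(1)]])
    show "j \<in> Hom C L N" "m \<cdot> q \<in> Hom C N W" "(m \<cdot> q) \<cdot> j = Zero C L W"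
      using A by (simp_all add: Hom_iff)
    fix V h assume h: "h \<in> Hom C V N" "(m \<cdot> q) \<cdot> h = Zero C V W"
    have "m \<cdot> (q \<cdot> h) = m \<cdot> Zero C V K" using A h by (simp add: Hom_iff)
    then have "q \<cdot> h = Zero C V K"
      by (rule monicD[OF assms(4)]) (use A h(1) in \<open>simp_all add: Hom_iff\<close>)
    with assms(1) h(1) show "\<exists>u. u \<in> Hom C V L \<and> j \<cdot> u = h" by (metis ses_lift)
  qed
  ultimately show ?thesis unfolding exact_at_def by blast
qed

lemma arrows_exact:
  assumes "resolution T r K" "p \<in> Hom C M K" "epic C p"
  shows "Cod C (arrows p r ! length r) = T" "epic C (arrows p r ! length r)"
    "\<forall>i<length r. exact_at C (arrows p r ! i) (arrows p r ! Suc i)"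
proof -
  have "Cod C (arrows p r ! length r) = T \<and> epic C (arrows p r ! length r) \<and>
    (\<forall>i<length r. exact_at C (arrows p r ! i) (arrows p r ! Suc i))"
    using assms
  proof (induction arbitrary: p M rule: resolution.induct)
    case Nil
    then show ?case by (simp add: Hom_iff)
  next
    case (Cons r K j q L N)
    note IH = Cons.IH[OF sesD(2,5)[OF Cons(2)]]
    obtain m W where "monic C m" "m \<in> Hom C K W" "arrows q r ! 0 = m \<cdot> q"
      using Cons(1) sesD(2)[OF Cons(2)] by (rule arrows_0)
    with exact_at_splice[OF Cons(2) Cons.prems(2,1)]
    have "exact_at C (j \<cdot> p) (arrows q r ! 0)" by simp
    then show ?case using IH by (auto simp: less_Suc_eq_0_disj)
  qed
  then show "Cod C (arrows p r ! length r) = T" "epic C (arrows p r ! length r)"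
    "\<forall>i<length r. exact_at C (arrows p r ! i) (arrows p r ! Suc i)" by auto
qed

lemma is_extension_arrows:
  assumes "resolution T r X" "r \<noteq> []"
  shows "is_extension C (length r) T X (arrows (Ident C X) r)"
proof -
  have X: "X \<in> Obj C" using resolution_Obj[OF assms(1)] by blast
  then have i: "Ident C X \<in> Hom C X X" "epic C (Ident C X)" by (auto simp: Ident_Hom epic_ident)
  have "monic C (arrows (Ident C X) r ! 0)"
    using assms by (cases rule: resolution.cases) (use sesD ses_Hom in force)+
  then show ?thesis
    using arrows_exact[OF assms(1) i] Dom_arrows_0[OF assms(1) i(1)] unfolding is_extension_def by simp
qed

text \<open>If \<open>h\<close> kills \<open>q\<close>, then \<open>q\<close> factors through the
  kernel \<open>l\<close> of \<open>h\<close>. The cokernel of \<open>k \<cdot> l\<close> kills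
  \<open>a\<close>, hence factors through \<open>c\<close> and kills \<open>k\<close>. As
  \<open>k \<cdot> l\<close> is the kernel of its cokernel, \<open>k\<close> factors through it;
  this splits \<open>l\<close>, so h = 0.\<close>

lemma image_factorization:
  assumes "is_cokernel C c a" "is_kernel C k c"
  obtains q where "q \<in> Hom C (Dom C a) (Dom C k)" "k \<cdot> q = a" "epic C q"
proof -
  note c = is_cokernelD[OF assms(1)] and k = is_kernelD[OF assms(2)]
  have "\<exists>q. q \<in> Hom C (Dom C a) (Dom C k) \<and> k \<cdot> q = a"
    using k(5)[of a "Dom C a"] c by simp
  then obtain q where q: "q \<in> Hom C (Dom C a) (Dom C k)" "k \<cdot> q = a" by blast
  note A = c(1,2)[unfolded Hom_iff] k(1)[unfolded Hom_iff] q(1)[unfolded Hom_iff]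
  have "epic C q"
  proof (rule epicI[OF q(1)])
    fix W h assume h: "h \<in> Hom C (Dom C k) W" "h \<cdot> q = Zero C (Dom C a) W"
    obtain l where l: "is_kernel C l h" using h(1) kernel_exists by (auto simp: Hom_iff)
    define U where "U = Dom C l"
    have l': "l \<in> Hom C U (Dom C k)" "h \<cdot> l = Zero C U W"
      using is_kernelD(1,3)[OF l] h(1) unfolding U_def by (simp_all add: Hom_iff)
    have "\<exists>v. v \<in> Hom C (Dom C a) U \<and> l \<cdot> v = q"
      using is_kernelD(5)[OF l, of q "Dom C a"] q(1) h unfolding U_def by (simp add: Hom_iff)
    then obtain v where v: "v \<in> Hom C (Dom C a) U" "l \<cdot> v = q" by blast
    have m: "monic C (k \<cdot> l)"
    proof (rule monicI)
      show "k \<cdot> l \<in> Hom C U (Cod C k)" using A l'(1) by (simp add: Hom_iff)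
      fix V y assume y: "y \<in> Hom C V U" "(k \<cdot> l) \<cdot> y = Zero C V (Cod C k)"
      have "k \<cdot> (l \<cdot> y) = k \<cdot> Zero C V (Dom C k)" using A l'(1) y by (simp add: Hom_iff)
      then have "l \<cdot> y = Zero C V (Dom C k)"
        by (rule monicD[OF kernel_monic[OF assms(2)]]) (use A l'(1) y(1) in \<open>simp_all add: Hom_iff\<close>)
      then have "l \<cdot> y = l \<cdot> Zero C V U" using l'(1) y(1) by (simp add: Hom_iff)
      then show "y = Zero C V U"
        by (rule monicD[OF kernel_monic[OF l]]) (use A l'(1) y(1) in \<open>simp_all add: Hom_iff\<close>)
    qed
    have "k \<cdot> l \<in> Hom C U (Cod C a)" using A l'(1) k(4) c(4) by (simp add: Hom_iff)
    with m obtain D c' where s: "ses (k \<cdot> l) c' U (Cod C a) D" by (rule monic_ses)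
    note A' = A ses_Hom[OF s] l'(1)[unfolded Hom_iff] v(1)[unfolded Hom_iff] k(4) c(4)
    have "c' \<cdot> a = c' \<cdot> (k \<cdot> (l \<cdot> v))" by (simp only: q(2) v(2))
    also have "\<dots> = (c' \<cdot> (k \<cdot> l)) \<cdot> v"
      using A ses_Hom(1-9)[OF s] l'(1) v(1) k(4) c(4) by (simp add: Hom_iff)
    also have "\<dots> = Zero C (Dom C a) D" unfolding ses_Hom(10)[OF s] using A' by simp
    finally have "c' \<cdot> a = Zero C (Dom C a) D" .
    then have "\<exists>w. w \<in> Hom C (Cod C c) D \<and> w \<cdot> c = c'"
      using c(5)[of c' D] A' by (simp add: Hom_iff)
    then obtain w where w: "w \<in> Hom C (Cod C c) D" "w \<cdot> c = c'" by blast
    have "c' \<cdot> k = (w \<cdot> c) \<cdot> k" by (simp only: w(2))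
    also have "\<dots> = w \<cdot> (c \<cdot> k)" using A w(1) k(4) by (simp add: Hom_iff)
    also have "\<dots> = Zero C (Dom C k) D" unfolding k(3) using A w(1) by (simp add: Hom_iff)
    finally have "c' \<cdot> k = Zero C (Dom C k) D" .
    moreover have "k \<in> Hom C (Dom C k) (Cod C a)" using A' by (simp add: Hom_iff)
    ultimately obtain x where x: "x \<in> Hom C (Dom C k) U" "(k \<cdot> l) \<cdot> x = k" using ses_lift[OF s] by blast
    have "k \<cdot> (l \<cdot> x) = k \<cdot> Ident C (Dom C k)" using x A' by (simp add: Hom_iff)
    then have "l \<cdot> x = Ident C (Dom C k)"
      by (rule monicD[OF kernel_monic[OF assms(2)]]) (use A' x(1) in \<open>simp_all add: Hom_iff\<close>)
    then have "h = h \<cdot> (l \<cdot> x)" using h(1) by (simp add: Hom_iff)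
    also have "\<dots> = (h \<cdot> l) \<cdot> x" using h(1) l'(1) x(1) by (simp add: Hom_iff)
    also have "\<dots> = Zero C (Dom C k) W" unfolding l'(2) using h(1) l'(1) x(1) by (simp add: Hom_iff)
    finally show "h = Zero C (Dom C k) W" .
  qed
  then show ?thesis using q that by blast
qed

text \<open>The initial monomorphism enters as a kernel \<open>j\<close> of the head instead of a
  list entry. Exactness after the first arrow \<open>a\<close> supplies its image \<open>k\<close>,
  which is the kernel of the next arrow and so plays the role of \<open>j\<close> for the
  tail.\<close>

lemma resolution_of_exact:
  assumes "e \<noteq> []" "is_kernel C j (hd e)" "epic C (last e)" "Cod C (last e) = T"
    "\<And>i. Suc i < length e \<Longrightarrow> exact_at C (e ! i) (e ! Suc i)"
  shows "\<exists>q r. resolution T ((j, q) # r) (Dom C j) \<and> arrows q r = e"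
  using assms
proof (induction e arbitrary: j)
  case (Cons a e)
  note j = is_kernelD[OF Cons.prems(2)]
  show ?case
  proof (cases "e = []")
    case True
    have a: "epic C a" "a \<in> Hom C (Cod C j) T" using True Cons.prems j by auto
    have "ses j a (Dom C j) (Cod C j) T"
      using j True Cons.prems by (intro sesI_epic) (auto simp: Hom_iff)
    moreover have "T \<in> Obj C" using a by (simp add: Hom_iff)
    ultimately show ?thesis using True by (intro exI[of _ a] exI[of _ "[]"])
        (auto intro: resolution.intros)
  next
    case False
    then have "exact_at C a (hd e)" using Cons.prems(5)[of 0] by (simp add: hd_conv_nth)
    then obtain k c where k: "is_cokernel C c a" "is_kernel C k c" "is_kernel C k (hd e)"
      unfolding exact_at_def is_image_def by blast
    have "exact_at C (e ! i) (e ! Suc i)" if "Suc i < length e" for i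
      using Cons.prems(5)[of "Suc i"] that by simp
    then have "\<exists>q r. resolution T ((k, q) # r) (Dom C k) \<and> arrows q r = e"
      using False k(3) Cons.prems(3,4) by (intro Cons.IH) simp_all
    then obtain q' r where r: "resolution T ((k, q') # r) (Dom C k)" "arrows q' r = e" by blast
    obtain q where q: "q \<in> Hom C (Dom C a) (Dom C k)" "k \<cdot> q = a" "epic C q"
      using k(1,2) by (rule image_factorization)
    note k' = is_kernelD[OF k(2)]
    note A = j(1)[simplified, unfolded Hom_iff] k'(1)[unfolded Hom_iff] q(1)[unfolded Hom_iff]
      j(2)[simplified, unfolded Hom_iff] j(4)[simplified]
    have kq: "k \<cdot> (q \<cdot> h) = a \<cdot> h" if "h \<in> Arr C" "Cod C h = Dom C a" for h
      using that A reassoc[OF q(2)] by simp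
    have ca: "Cod C k = Cod C a" using q(2) A comp_simps(3)[of q k] by simp
    have "is_kernel C j q"
    proof (rule is_kernelI[OF kernel_monic[OF Cons.prems(2)]])
      show "j \<in> Hom C (Dom C j) (Dom C a)" "q \<in> Hom C (Dom C a) (Dom C k)" using A by (simp_all add: Hom_iff)
      have "k \<cdot> (q \<cdot> j) = k \<cdot> Zero C (Dom C j) (Dom C k)" using A j(3) ca by (simp add: kq)
      then show "q \<cdot> j = Zero C (Dom C j) (Dom C k)"
        by (rule monicD[OF kernel_monic[OF k(2)]]) (use A in simp_all)
      fix W h assume h: "h \<in> Hom C W (Dom C a)" "q \<cdot> h = Zero C W (Dom C k)"
      have "a \<cdot> h = k \<cdot> (q \<cdot> h)" using kq h(1) by (simp add: Hom_iff)
      also have "\<dots> = Zero C W (Cod C a)" using h A ca by (simp add: Hom_iff)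
      finally show "\<exists>u. u \<in> Hom C W (Dom C j) \<and> j \<cdot> u = h" using j(5)[of h W] h(1) by simp
    qed
    then have "ses j q (Dom C j) (Dom C a) (Dom C k)"
      using q(3) A by (intro sesI_epic) (auto simp: Hom_iff)
    then have "resolution T ((j, q) # (k, q') # r) (Dom C j)" by (rule resolution.Cons[OF r(1)])
    moreover have "arrows q ((k, q') # r) = a # e" using r(2) q(2) by simp
    ultimately show ?thesis by blast
  qed
qed simp

lemma is_extension_resolution:
  assumes "is_extension C n T X e" "n \<ge> 1"
  obtains r where "resolution T r X" "length r = n" "arrows (Ident C X) r = e"
proof -
  have e: "length e = Suc n" "Dom C (e ! 0) = X" "Cod C (e ! n) = T" "monic C (e ! 0)"
    "epic C (e ! n)" "\<And>i. i < n \<Longrightarrow> exact_at C (e ! i) (e ! Suc i)"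
    using assms(1) unfolding is_extension_def by auto
  obtain j es where es: "e = j # es" using e(1) by (cases e) auto
  have es': "es \<noteq> []" "length es = n" using es e(1) assms(2) by auto
  have "exact_at C j (hd es)" using e(6)[of 0] es assms(2) es' by (simp add: hd_conv_nth)
  then obtain k c where k: "is_cokernel C c j" "is_kernel C k c" "is_kernel C k (hd es)"
    unfolding exact_at_def is_image_def by blast
  note k' = is_kernelD[OF k(3)]
  obtain q where q: "q \<in> Hom C (Dom C j) (Dom C k)" "k \<cdot> q = j" using k(1,2) by (rule image_factorization)
  have j: "monic C j" "Dom C j = X" using e es by auto
  \<comment> \<open>Exactness gives the kernel property to some image \<open>k\<close> of
    \<open>j\<close>, not to \<open>j\<close> itself. A monomorphism is its own image, so
    \<open>j\<close> and \<open>k\<close> factor through each other and the property passes to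
    \<open>j\<close>.\<close>
  have jc: "is_kernel C j c" using j(1) k(1) by (rule monic_kernel_cokernel)
  note jc' = is_kernelD[OF jc]
  have "\<exists>v. v \<in> Hom C (Dom C k) (Dom C j) \<and> j \<cdot> v = k"
    using jc'(5)[of k "Dom C k"] is_kernelD[OF k(2)] by simp
  then obtain v where v: "v \<in> Hom C (Dom C k) (Dom C j)" "j \<cdot> v = k" by blast
  note A = k'(1,2)[unfolded Hom_iff] q(1)[unfolded Hom_iff] jc'(1)[unfolded Hom_iff] v(1)[unfolded Hom_iff]
  have cod: "Cod C j = Cod C k" using q(2) A comp_simps(3)[of q k] by simp
  have "is_kernel C j (hd es)"
  proof (rule is_kernelI[OF j(1)])
    show "j \<in> Hom C (Dom C j) (Dom C (hd es))" "hd es \<in> Hom C (Dom C (hd es)) (Cod C (hd es))"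
      using A cod k'(4) by (simp_all add: Hom_iff)
    have "hd es \<cdot> j = (hd es \<cdot> k) \<cdot> q" using A q(2) by simp
    also have "\<dots> = Zero C (Dom C j) (Cod C (hd es))" unfolding k'(3) using A by simp
    finally show "hd es \<cdot> j = Zero C (Dom C j) (Cod C (hd es))" .
    fix W h assume h: "h \<in> Hom C W (Dom C (hd es))" "hd es \<cdot> h = Zero C W (Cod C (hd es))"
    then obtain u where u: "u \<in> Hom C W (Dom C k)" "k \<cdot> u = h" using k'(5) by blast
    have "j \<cdot> (v \<cdot> u) = h" using u A by (simp add: reassoc[OF v(2)] Hom_iff)
    then show "\<exists>u. u \<in> Hom C W (Dom C j) \<and> j \<cdot> u = h" using u(1) A by (intro exI[of _ "v \<cdot> u"]) (simp add: Hom_iff)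
  qed
  then have "\<exists>q r. resolution T ((j, q) # r) (Dom C j) \<and> arrows q r = es"
  proof (rule resolution_of_exact[OF es'(1)])
    show "epic C (last es)" "Cod C (last es) = T"
      using es es' e(3,5) by (simp_all add: last_conv_nth nth_Cons split: nat.splits)
    show "exact_at C (es ! i) (es ! Suc i)" if "Suc i < length es" for i
      using e(6)[of "Suc i"] that es es'(2) by simp
  qed
  then obtain q' r where r: "resolution T ((j, q') # r) X" "arrows q' r = es" using j(2) by auto
  have "arrows (Ident C X) ((j, q') # r) = e" using r(2) es j A by simp
  moreover have "length ((j, q') # r) = n" using r(2) es'(2) by auto
  ultimately show ?thesis using that r(1) by blast
qed

text \<open>General \<open>p\<close> and \<open>p'\<close> drive the induction: on the tails they
  become \<open>q\<close> and \<open>q'\<close>, and \<open>h\<close> shifts by one. The left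
  component \<open>c\<close> comes from the kernel property of \<open>j\<close>.\<close>

lemma refines_of_chain_map:
  assumes "resolution T r K" "resolution T r' K'" "length r' = length r"
    "p \<in> Hom C M K" "p' \<in> Hom C M' K'" "h 0 \<in> Hom C M' M" "h (Suc (length r)) = Ident C T"
    "\<And>i. i \<le> length r \<Longrightarrow> h i \<in> Hom C (Dom C (arrows p' r' ! i)) (Dom C (arrows p r ! i))"
    "\<And>i. i \<le> length r \<Longrightarrow> arrows p r ! i \<cdot> h i = h (Suc i) \<cdot> arrows p' r' ! i"
  shows "\<exists>c. refines T r' K' r K c \<and> c \<cdot> p' = p \<cdot> h 0"
  using assms
proof (induction arbitrary: p M r' K' p' M' h rule: resolution.induct)
  case Nil
  have "r' = []" "K' = T" using Nil(2,3) by (auto elim: resolution.cases)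
  then show ?case using Nil refines.Nil[OF Nil(1)] by (intro exI[of _ "Ident C T"]) simp
next
  case (Cons r K j q L N)
  from Cons.prems(1) Cons.prems(2) obtain j' q' r1' K1' N' where
    r': "r' = (j', q') # r1'" "resolution T r1' K1'" and s': "ses j' q' K' N' K1'"
    by (auto elim: resolution_posE)
  have h1: "h (Suc 0) \<in> Hom C N' N"
    using Cons.prems(7)[of 1] Dom_arrows_0[OF r'(2) sesD(2)[OF s']]
      Dom_arrows_0[OF Cons(1) sesD(2)[OF Cons(2)]] r'(1) by simp
  have "\<exists>c. refines T r1' K1' r K c \<and> c \<cdot> q' = q \<cdot> h (Suc 0)"
  proof (rule Cons.IH[OF r'(2) _ sesD(2)[OF Cons(2)] sesD(2)[OF s']])
    show "length r1' = length r" "h (Suc 0) \<in> Hom C N' N" "h (Suc (Suc (length r))) = Ident C T"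
      using Cons.prems(2,6) r'(1) h1 by simp_all
    fix i assume "i \<le> length r"
    then show "h (Suc i) \<in> Hom C (Dom C (arrows q' r1' ! i)) (Dom C (arrows q r ! i))"
      "arrows q r ! i \<cdot> h (Suc i) = h (Suc (Suc i)) \<cdot> arrows q' r1' ! i"
      using Cons.prems(7,8)[of "Suc i"] r'(1) by simp_all
  qed
  then obtain c1 where c1: "refines T r1' K1' r K c1" "q \<cdot> h (Suc 0) = c1 \<cdot> q'" by auto
  note A = ses_Hom[OF Cons(2)] ses_Hom[OF s'] h1[unfolded Hom_iff]
    refinesD(3)[OF c1(1), unfolded Hom_iff] Cons.prems(3,4,5)[unfolded Hom_iff]
  have "h (Suc 0) \<cdot> j' \<in> Hom C K' N" "q \<cdot> (h (Suc 0) \<cdot> j') = Zero C K' K"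
    using A by (simp_all add: Hom_iff reassoc[OF c1(2)])
  with Cons(2) obtain c where c: "c \<in> Hom C K' L" "j \<cdot> c = h (Suc 0) \<cdot> j'" by (rule ses_lift)
  have "j \<cdot> (p \<cdot> h 0) = h (Suc 0) \<cdot> (j' \<cdot> p')" using Cons.prems(8)[of 0] r'(1) A by simp
  also have "\<dots> = j \<cdot> (c \<cdot> p')" using A c(1) by (simp add: reassoc[OF c(2)] Hom_iff)
  finally have "j \<cdot> (c \<cdot> p') = j \<cdot> (p \<cdot> h 0)" by (rule sym)
  then have "c \<cdot> p' = p \<cdot> h 0"
    by (rule monicD[OF sesD(4)[OF Cons(2)]]) (use A c(1) in \<open>simp_all add: Hom_iff\<close>)
  moreover have "refines T r' K' ((j, q) # r) L c"
    unfolding r'(1) by (rule refines.Cons[OF c1(1) s' Cons(2) h1 c(1) c1(2) c(2)])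
  ultimately show ?case by blast
qed

lemma chain_map_of_refines:
  assumes "refines T r' K' r K c" "p \<in> Hom C M K" "p' \<in> Hom C M' K'" "h0 \<in> Hom C M' M"
    "p \<cdot> h0 = c \<cdot> p'"
  shows "\<exists>h. h 0 = h0 \<and> h (Suc (length r)) = Ident C T \<and>
    (\<forall>i\<le>length r. h i \<in> Hom C (Dom C (arrows p' r' ! i)) (Dom C (arrows p r ! i)) \<and>
      arrows p r ! i \<cdot> h i = h (Suc i) \<cdot> arrows p' r' ! i)"
  using assms
proof (induction arbitrary: p p' M M' h0 rule: refines.induct)
  case Nil
  then show ?case by (intro exI[of _ "case_nat h0 (\<lambda>_. Ident C T)"]) (simp add: Hom_iff)
next
  case (Cons r' K' r K c j' q' L' N' j q L N b c')
  obtain h where h: "h 0 = b" "h (Suc (length r)) = Ident C T"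
    "\<And>i. i \<le> length r \<Longrightarrow> h i \<in> Hom C (Dom C (arrows q' r' ! i)) (Dom C (arrows q r ! i))"
    "\<And>i. i \<le> length r \<Longrightarrow> arrows q r ! i \<cdot> h i = h (Suc i) \<cdot> arrows q' r' ! i"
    using Cons.IH[OF sesD(2)[OF Cons(3)] sesD(2)[OF Cons(2)] Cons(4) Cons(6)] by blast
  note A = ses_Hom[OF Cons(2)] ses_Hom[OF Cons(3)] Cons(4,5)[unfolded Hom_iff]
    Cons.prems(1-3)[unfolded Hom_iff]
  have "(j \<cdot> p) \<cdot> h0 = b \<cdot> (j' \<cdot> p')"
    using A Cons.prems(4) by (simp add: reassoc[OF Cons(7)])
  then show ?case
  proof (intro exI[of _ "case_nat h0 h"] conjI allI impI)
    fix i assume i: "i \<le> length ((j, q) # r)"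
    show "case_nat h0 h i \<in> Hom C (Dom C (arrows p' ((j', q') # r') ! i)) (Dom C (arrows p ((j, q) # r) ! i))"
      using i h(3) A by (cases i) (simp_all add: Hom_iff)
    show "arrows p ((j, q) # r) ! i \<cdot> case_nat h0 h i =
        case_nat h0 h (Suc i) \<cdot> arrows p' ((j', q') # r') ! i"
      if "(j \<cdot> p) \<cdot> h0 = b \<cdot> (j' \<cdot> p')"
      using i h(1,4) that by (cases i) simp_all
  qed (use h(2) in simp_all)
qed

text \<open>Turns a generator of Yoneda equivalence into a refinement, so that effacement can be
  carried along zigzags.\<close>

lemma extension_map_arrows_iff:
  assumes r: "resolution T r X" "length r = n" and r': "resolution T r' X" "length r' = n"
    and "n \<ge> 1"
  shows "extension_map C n T X (arrows (Ident C X) r') (arrows (Ident C X) r) \<longleftrightarrow>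
    refines T r' X r X (Ident C X)"
proof
  have X: "X \<in> Obj C" "Ident C X \<in> Hom C X X" using resolution_Obj[OF r(1)] by (auto simp: Ident_Hom)
  have D: "Dom C (arrows (Ident C X) r ! 0) = X" "Dom C (arrows (Ident C X) r' ! 0) = X"
    using Dom_arrows_0 r(1) r'(1) X(2) by blast+
  {
    assume "extension_map C n T X (arrows (Ident C X) r') (arrows (Ident C X) r)"
    then obtain h where h: "h 0 = Ident C X" "h (Suc n) = Ident C T"
      "\<And>i. 1 \<le> i \<Longrightarrow> i \<le> n \<Longrightarrow> h i \<in> Hom C (Dom C (arrows (Ident C X) r' ! i)) (Dom C (arrows (Ident C X) r ! i))"
      "\<And>i. i \<le> n \<Longrightarrow> arrows (Ident C X) r ! i \<cdot> h i = h (Suc i) \<cdot> arrows (Ident C X) r' ! i"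
      unfolding extension_map_def by auto
    have "h i \<in> Hom C (Dom C (arrows (Ident C X) r' ! i)) (Dom C (arrows (Ident C X) r ! i))"
      if "i \<le> n" for i using h(1,3) that D X by (cases i) simp_all
    then have "\<exists>c. refines T r' X r X c \<and> c \<cdot> Ident C X = Ident C X \<cdot> h 0"
      using h r r' X by (intro refines_of_chain_map) simp_all
    then obtain c where c: "refines T r' X r X c" "c \<cdot> Ident C X = Ident C X \<cdot> h 0" by blast
    then have "c = Ident C X" using refinesD(3)[OF c(1)] X h(1) by (simp add: Hom_iff)
    then show "refines T r' X r X (Ident C X)" using c(1) by simp
  }
  assume "refines T r' X r X (Ident C X)"
  from chain_map_of_refines[OF this X(2) X(2) X(2) refl]
  show "extension_map C n T X (arrows (Ident C X) r') (arrows (Ident C X) r)"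
    using is_extension_arrows[OF r(1)] is_extension_arrows[OF r'(1)] r(2) r'(2) \<open>n \<ge> 1\<close>
    unfolding extension_map_def by fastforce
qed

section \<open>The trivial extension as a resolution\<close>

primrec zero_resolution :: "'a \<Rightarrow> 'a \<Rightarrow> nat \<Rightarrow> ('b \<times> 'b) list"
  where
    "zero_resolution T Z 0 = [(Zero C Z T, Ident C T)]"
  | "zero_resolution T Z (Suc n) = (Zero C Z Z, Zero C Z Z) # zero_resolution T Z n"

lemma length_zero_resolution [simp]: "length (zero_resolution T Z n) = Suc n"
  by (induction n) auto

lemma zero_objectD:
  assumes "zero_object C Z"
  shows "Z \<in> Obj C" "f \<in> Hom C W Z \<Longrightarrow> f = Zero C W Z" "f \<in> Hom C Z W \<Longrightarrow> f = Zero C Z W"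
proof -
  show Z: "Z \<in> Obj C" using assms unfolding zero_object_def by blast
  have u: "\<exists>!f. f \<in> Hom C W Z" "\<exists>!f. f \<in> Hom C Z W" if "W \<in> Obj C" for W
    using assms that unfolding zero_object_def by blast+
  show "f = Zero C W Z" if "f \<in> Hom C W Z"
  proof -
    have "W \<in> Obj C" "Zero C W Z \<in> Hom C W Z" using that Z by (simp_all add: Hom_iff)
    with u(1)[OF this(1)] that show ?thesis by blast
  qed
  show "f = Zero C Z W" if "f \<in> Hom C Z W"
  proof -
    have "W \<in> Obj C" "Zero C Z W \<in> Hom C Z W" using that Z by (simp_all add: Hom_iff)
    with u(2)[OF this(1)] that show ?thesis by blast
  qed
qed

lemma ses_Ident_left:
  assumes Z: "zero_object C Z" and X: "X \<in> Obj C"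
  shows "ses (Ident C X) (Zero C X Z) X X Z"
proof (rule sesI_monic[OF is_cokernelI])
  note z = zero_objectD[OF Z]
  show "epic C (Zero C X Z)"
  proof (rule epicI)
    show "Zero C X Z \<in> Hom C X Z" using X z(1) by (simp add: Hom_iff)
  qed (rule z(3))
  show "Ident C X \<in> Hom C X X" "Zero C X Z \<in> Hom C X Z" "Zero C X Z \<cdot> Ident C X = Zero C X Z"
    using X z(1) by (simp_all add: Hom_iff)
  then show "Ident C X \<in> Hom C X X" "Zero C X Z \<in> Hom C X Z" by simp_all
  show "monic C (Ident C X)" using X by (rule monic_ident)
  fix W h assume "h \<in> Hom C X W" "h \<cdot> Ident C X = Zero C X W"
  then show "\<exists>u. u \<in> Hom C Z W \<and> u \<cdot> Zero C X Z = h"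
    using z(1) by (intro exI[of _ "Zero C Z W"]) (simp add: Hom_iff)
qed

lemma ses_Ident_right:
  assumes Z: "zero_object C Z" and X: "X \<in> Obj C"
  shows "ses (Zero C Z X) (Ident C X) Z X X"
proof (rule sesI_epic[OF is_kernelI])
  note z = zero_objectD[OF Z]
  show "monic C (Zero C Z X)"
  proof (rule monicI)
    show "Zero C Z X \<in> Hom C Z X" using X z(1) by (simp add: Hom_iff)
  qed (rule z(2))
  show "Ident C X \<in> Hom C X X" "Zero C Z X \<in> Hom C Z X" "Ident C X \<cdot> Zero C Z X = Zero C Z X"
    using X z(1) by (simp_all add: Hom_iff)
  then show "Ident C X \<in> Hom C X X" "Zero C Z X \<in> Hom C Z X" by simp_all
  show "epic C (Ident C X)" using X by (rule epic_ident)
  fix W h assume "h \<in> Hom C W X" "Ident C X \<cdot> h = Zero C W X"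
  then show "\<exists>u. u \<in> Hom C W Z \<and> Zero C Z X \<cdot> u = h"
    using z(1) by (intro exI[of _ "Zero C W Z"]) (simp add: Hom_iff)
qed

lemma resolution_zero_resolution:
  assumes Z: "zero_object C Z" and T: "T \<in> Obj C"
  shows "resolution T (zero_resolution T Z n) Z"
proof (induction n)
  case 0
  show ?case using resolution.Cons[OF resolution.Nil[OF T] ses_Ident_right[OF Z T]] by simp
next
  case (Suc n)
  have "Ident C Z = Zero C Z Z"
    using zero_objectD(1,2)[OF Z] by (simp add: Ident_Hom)
  then have "ses (Zero C Z Z) (Zero C Z Z) Z Z Z"
    using ses_Ident_left[OF Z zero_objectD(1)[OF Z]] by simp
  from resolution.Cons[OF Suc this] show ?case by simp
qed

text \<open>The map is the epimorphism onto \<open>T\<close> in the last place and zero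
  elsewhere.\<close>

lemma refines_zero_resolution:
  assumes Z: "zero_object C Z" and "resolution T r K" "length r = Suc n"
  shows "refines T r K (zero_resolution T Z n) Z (Zero C K Z)"
  using assms(2,3)
proof (induction n arbitrary: r K)
  case 0
  then obtain j q r1 N L where r1: "r = (j, q) # r1" "resolution T r1 L" "ses j q K N L"
    by (auto elim: resolution_posE)
  moreover have "r1 = []" using 0 r1(1) by simp
  moreover have "L = T" using r1(2) \<open>r1 = []\<close> by (auto elim: resolution.cases)
  ultimately have r: "r = [(j, q)]" and s: "ses j q K N T" by auto
  have T: "T \<in> Obj C" using ses_Hom[OF s] by simp
  note z = zero_objectD(1)[OF Z] and A = ses_Hom[OF s]
  have "q \<in> Hom C N T" "Zero C K Z \<in> Hom C K Z" "Ident C T \<cdot> q = Ident C T \<cdot> q"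
    "Zero C Z T \<cdot> Zero C K Z = q \<cdot> j"
    using z A by (simp_all add: Hom_iff)
  from refines.Cons[OF refines.Nil[OF T] s ses_Ident_right[OF Z T] this] show ?case unfolding r by simp
next
  case (Suc n)
  from Suc.prems obtain j q r1 N L where r: "r = (j, q) # r1" and r1: "resolution T r1 L"
    and s: "ses j q K N L" by (auto elim: resolution_posE)
  note z = zero_objectD(1)[OF Z] and A = ses_Hom[OF s]
  have i: "Ident C Z = Zero C Z Z"
    using zero_objectD(1,2)[OF Z] by (simp add: Ident_Hom)
  then have sz: "ses (Zero C Z Z) (Zero C Z Z) Z Z Z"
    using ses_Ident_left[OF Z zero_objectD(1)[OF Z]] by simp
  have l: "length r1 = Suc n" using Suc.prems(2) r by simp
  have "Zero C N Z \<in> Hom C N Z" "Zero C K Z \<in> Hom C K Z" "Zero C Z Z \<cdot> Zero C N Z = Zero C L Z \<cdot> q"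
    "Zero C Z Z \<cdot> Zero C K Z = Zero C N Z \<cdot> j"
    using z A by (simp_all add: Hom_iff)
  from refines.Cons[OF Suc.IH[OF r1 l] s sz this] show ?case unfolding r by simp
qed

text \<open>The offset \<open>k\<close> serves the induction: dropping the first arrow shifts all
  indices by one and replaces \<open>W\<close> by \<open>Z\<close>. The value k = 1 gives the
  indexing of \<open>trivial_extension\<close>.\<close>

lemma arrows_zero_resolution:
  assumes Z: "zero_object C Z" and T: "T \<in> Obj C" and W: "W \<in> Obj C"
  shows "arrows (Zero C W Z) (zero_resolution T Z m) =
    map (\<lambda>i. Zero C (if i = k then W else if i = k + Suc m then T else Z)
      (if Suc i = k then W else if Suc i = k + Suc m then T else Z)) [k..<k + Suc m] @ [Ident C T]"
  using W
proof (induction m arbitrary: W k)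
  case 0
  then show ?case using zero_objectD(1)[OF Z] T by simp
next
  case (Suc m)
  let ?f = "\<lambda>W k i. Zero C (if i = k then W else if i = k + Suc m then T else Z)
      (if Suc i = k then W else if Suc i = k + Suc m then T else Z)"
  let ?g = "\<lambda>i. Zero C (if i = k then W else if i = k + Suc (Suc m) then T else Z)
      (if Suc i = k then W else if Suc i = k + Suc (Suc m) then T else Z)"
  have "arrows (Zero C W Z) (zero_resolution T Z (Suc m)) =
      Zero C W Z # map (?f Z (Suc k)) [Suc k..<Suc k + Suc m] @ [Ident C T]"
    using Suc.IH[of Z "Suc k"] zero_objectD(1)[OF Z] Suc.prems by simp
  also have "map (?f Z (Suc k)) [Suc k..<Suc k + Suc m] = map ?g [Suc k..<Suc k + Suc m]"
    by (rule map_cong) auto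
  also have "Zero C W Z # map ?g [Suc k..<Suc k + Suc m] @ [Ident C T] =
      map ?g (k # [Suc k..<Suc k + Suc m]) @ [Ident C T]" by simp
  also have "k # [Suc k..<Suc k + Suc m] = [k..<k + Suc (Suc m)]"
    by (subst upt_conv_Cons) simp_all
  finally show ?case .
qed

lemma trivial_extension_arrows:
  assumes Z: "zero_object C Z" and T: "T \<in> Obj C" and X: "X \<in> Obj C"
  shows "trivial_extension C (Suc (Suc m)) T X
    (arrows (Ident C X) ((Ident C X, Zero C X Z) # zero_resolution T Z m))"
proof -
  have "arrows (Zero C X Z) (zero_resolution T Z m) =
    map (\<lambda>i. Zero C (if i = 1 then X else if i = Suc (Suc m) then T else Z)
      (if Suc i = 1 then X else if Suc i = Suc (Suc m) then T else Z)) [1..<Suc (Suc m)] @ [Ident C T]"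
    using arrows_zero_resolution[OF assms, of m 1] by simp
  then show ?thesis unfolding trivial_extension_def Let_def using Z X by auto
qed

lemma effaced_trivial:
  assumes Z: "zero_object C Z" and T: "T \<in> Obj C" and X: "X \<in> Obj C"
  shows "effaced T ((Ident C X, Zero C X Z) # zero_resolution T Z m) X X (Ident C X)"
proof -
  have s: "ses (Ident C X) (Zero C X Z) X X Z" using ses_Ident_left[OF Z X] .
  from refines_refl[OF resolution.Cons[OF resolution_zero_resolution[OF Z T] s]] s
  show ?thesis by (rule effacedI[where g = "Ident C X"]) (use X in \<open>auto simp: Ident_Hom\<close>)
qed

section \<open>Yoneda vanishing compared with effaceability\<close>

lemma Ext_vanishesD:
  assumes "Ext_vanishes C n T X" "is_extension C n T X e" "is_extension C n T X e'"
  shows "equivclp (extension_map C n T X) e e'"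
proof -
  have "Ext_rel C n T X `` {e} \<in> Ext C n T X" "Ext_rel C n T X `` {e'} \<in> Ext C n T X"
    using assms(2,3) unfolding Ext_def by (auto intro: quotientI)
  then have "Ext_rel C n T X `` {e} = Ext_rel C n T X `` {e'}"
    using assms(1) unfolding Ext_vanishes_def by (metis singletonD)
  moreover have "e' \<in> Ext_rel C n T X `` {e'}" using assms(3) by (simp add: Ext_rel_def)
  ultimately have "(e, e') \<in> Ext_rel C n T X" by blast
  then show ?thesis unfolding Ext_rel_def by simp
qed

text \<open>When everything is equivalent to \<open>e0\<close>, each class is the whole set of
  extensions, and so is the union \<open>Ext_zero\<close>.\<close>

lemma Ext_vanishesI:
  assumes "trivial_extension C n T X e0" "is_extension C n T X e0"
    and "\<And>e. is_extension C n T X e \<Longrightarrow> equivclp (extension_map C n T X) e e0"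
  shows "Ext_vanishes C n T X"
proof -
  let ?S = "{e. is_extension C n T X e}"
  have "equivclp (extension_map C n T X) e e'"
    if "is_extension C n T X e" "is_extension C n T X e'" for e e'
    using assms(3)[OF that(1)] assms(3)[OF that(2)] by (metis equivclp_sym equivclp_trans)
  then have c: "Ext_rel C n T X `` {e} = ?S" if "e \<in> ?S" for e
    using that unfolding Ext_rel_def by auto
  then have "Ext_zero C n T X = ?S"
  proof -
    have "?S \<subseteq> Ext_zero C n T X"
      using c[of e0] assms(1,2) unfolding Ext_zero_def by blast
    moreover have "Ext_zero C n T X \<subseteq> ?S" unfolding Ext_zero_def Ext_rel_def by blast
    ultimately show ?thesis by (rule antisym[rotated])
  qed
  moreover have "Ext C n T X = {?S}"
    using c assms(2) unfolding Ext_def quotient_def by auto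
  ultimately show ?thesis unfolding Ext_vanishes_def by simp
qed

lemma effaced_Ident_iff:
  assumes "refines T r X t X (Ident C X)" "r \<noteq> []"
  shows "effaced T r X X (Ident C X) \<longleftrightarrow> effaced T t X X (Ident C X)"
proof -
  have "X \<in> Obj C" using refinesD(3)[OF assms(1)] by (simp add: Hom_iff)
  then show ?thesis
    using effaced_refines_iff[OF assms Ident_Hom] by simp
qed

text \<open>The class of \<open>(r, f)\<close> is that of the pushout \<open>r'\<close> with the
  identity, and a zigzag joins \<open>r'\<close> to the trivial extension. Effacement travels along
  it by \<open>effaced_Ident_iff\<close>.\<close>

lemma Ext_vanishes_imp_effaceable:
  assumes v: "Ext_vanishes C n T P" and n: "n \<ge> 2"
  shows "effaceable T n P"
  unfolding effaceable_def
proof (intro allI ballI impI)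
  fix r K f assume f: "f \<in> Hom C K P" and r: "resolution T r K" "length r = n"
  obtain m where m: "n = Suc (Suc m)" using n by (metis Suc_diff_le add_2_eq_Suc le_Suc_ex)
  have TP: "T \<in> Obj C" "P \<in> Obj C" using resolution_Obj[OF r(1)] f by (auto simp: Hom_iff)
  obtain Z where Z: "zero_object C Z" using zero_object_exists by blast
  define z where "z = (Ident C P, Zero C P Z) # zero_resolution T Z m"
  have z: "resolution T z P" "length z = n"
    unfolding z_def m
    using resolution.Cons[OF resolution_zero_resolution[OF Z TP(1)] ses_Ident_left[OF Z TP(2)]] by simp_all
  let ?e = "arrows (Ident C P)" and ?i = "Ident C P"
  have i: "?i \<in> Hom C P P" using TP by (simp add: Ident_Hom)
  obtain j q r1 N L where r1: "r = (j, q) # r1" and r1': "resolution T r1 L" and s: "ses j q K N L"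
    using r n by (auto elim: resolution_posE)
  obtain j' q' M b where s': "ses j' q' P M L" and b: "b \<in> Hom C N M" "b \<cdot> j = j' \<cdot> f" "q' \<cdot> b = q"
    by (rule ses_pushout[OF s f])
  define r' where "r' = (j', q') # r1"
  have "q' \<cdot> b = Ident C L \<cdot> q" using b(3) ses_Hom[OF s] by simp
  then have rr': "refines T r K r' P f"
    unfolding r1 r'_def using refines.Cons[OF refines_refl[OF r1'] s s' b(1) f] b(2) by simp
  have r': "resolution T r' P" "length r' = n"
    using refinesD(2,4)[OF rr'] r(2) by simp_all
  \<comment> \<open>A list of arrows fixes its short exact pieces only up to the choice of images,
    so the invariant ranges over all decompositions of \<open>e\<close>.\<close>
  define Q where "Q e \<longleftrightarrow> (\<forall>s. resolution T s P \<longrightarrow> length s = n \<longrightarrow> ?e s = e \<longrightarrow> effaced T s P P ?i)" for e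
  have step: "Q e \<longleftrightarrow> Q e'" if "extension_map C n T P e e'" for e e'
  proof -
    have "is_extension C n T P e" "is_extension C n T P e'" using that unfolding extension_map_def by auto
    moreover have "n \<ge> 1" using n by simp
    ultimately obtain s1 s2 where s1: "resolution T s1 P" "length s1 = n" "?e s1 = e"
      and s2: "resolution T s2 P" "length s2 = n" "?e s2 = e'"
      by (metis is_extension_resolution)
    have *: "effaced T t1 P P ?i \<longleftrightarrow> effaced T t2 P P ?i"
      if "resolution T t1 P" "length t1 = n" "?e t1 = e" "resolution T t2 P" "length t2 = n" "?e t2 = e'"
      for t1 t2
    proof -
      have "refines T t1 P t2 P ?i"
        using extension_map_arrows_iff[OF that(4,5,1,2)] that n \<open>extension_map C n T P e e'\<close> by simp
      moreover have "t1 \<noteq> []" using that n by auto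
      ultimately show ?thesis by (rule effaced_Ident_iff)
    qed
    show ?thesis unfolding Q_def using * s1 s2 by blast
  qed
  have "is_extension C n T P (?e z)" "is_extension C n T P (?e r')"
  proof -
    have "z \<noteq> []" "r' \<noteq> []" using z(2) r'(2) n by auto
    then show "is_extension C n T P (?e z)" "is_extension C n T P (?e r')"
      using is_extension_arrows[OF z(1)] is_extension_arrows[OF r'(1)] z(2) r'(2) by simp_all
  qed
  then have "equivclp (extension_map C n T P) (?e z) (?e r')" by (rule Ext_vanishesD[OF v])
  then have Q: "Q (?e z) \<longleftrightarrow> Q (?e r')"
    by (induction rule: equivclp_induct) (use step in auto)
  \<comment> \<open>Another decomposition \<open>s\<close> of the trivial extension is compared with
    \<open>z\<close> through the identity map of that extension.\<close>
  have "effaced T s P P ?i" if "resolution T s P" "length s = n" "?e s = ?e z" for s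
  proof -
    have "extension_map C n T P (?e z) (?e z)"
      using extension_map_arrows_iff[OF z z] refines_refl[OF z(1)] n by simp
    then have "refines T s P z P ?i"
      using extension_map_arrows_iff[OF z that(1,2)] that(3) n by simp
    moreover have "s \<noteq> []" using that(2) n by auto
    ultimately show ?thesis
      using effaced_Ident_iff effaced_trivial[OF Z TP] unfolding z_def by blast
  qed
  then have "Q (?e z)" unfolding Q_def by blast
  then have "effaced T r' P P ?i" using Q r' unfolding Q_def by blast
  then have "effaced T r K P (?i \<cdot> f)"
    using effaced_refines_iff[OF rr' _ i] r1 by simp
  then show "effaced T r K P f" using f by (simp add: Hom_iff)
qed

text \<open>Effacing the identity of \<open>X\<close> splits the first piece after the tail is
  refined. The resolution whose first term is the biproduct of \<open>X\<close> and
  \<open>K'\<close> maps to the given extension and to the trivial one, a zigzag of length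
  two.\<close>

lemma effaceable_imp_Ext_vanishes:
  assumes v: "effaceable T n X" and n: "n \<ge> 2" and TX: "T \<in> Obj C" "X \<in> Obj C"
  shows "Ext_vanishes C n T X"
proof -
  obtain m where m: "n = Suc (Suc m)" using n by (metis Suc_diff_le add_2_eq_Suc le_Suc_ex)
  obtain Z where Z: "zero_object C Z" using zero_object_exists by blast
  let ?z = "(Ident C X, Zero C X Z) # zero_resolution T Z m"
  note sz = ses_Ident_left[OF Z TX(2)]
  have z: "resolution T ?z X" "length ?z = n"
    unfolding m using resolution.Cons[OF resolution_zero_resolution[OF Z TX(1)] sz] by simp_all
  let ?e = "arrows (Ident C X)" and ?i = "Ident C X"
  have i: "?i \<in> Hom C X X" using TX by (simp add: Ident_Hom)
  have "equivclp (extension_map C n T X) e (?e ?z)" if e: "is_extension C n T X e" for e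
  proof -
    have "n \<ge> 1" using n by simp
    with e obtain r where r: "resolution T r X" "length r = n" "?e r = e"
      by (rule is_extension_resolution)
    obtain j q r1 N L where r1: "r = (j, q) # r1" and r1': "resolution T r1 L" and s: "ses j q X N L"
      using r n by (auto elim: resolution_posE)
    have "effaced T ((j, q) # r1) X X ?i" using effaceableD[OF v r(1,2) i] r1 by simp
    then obtain j' q' r' K' L' N' b c d g where r': "refines T r' K' r1 L d" and s': "ses j' q' L' N' K'"
      and h: "b \<in> Hom C N' N" "c \<in> Hom C L' X" "q \<cdot> b = d \<cdot> q'" "j \<cdot> c = b \<cdot> j'"
        "g \<in> Hom C N' X" "g \<cdot> j' = ?i \<cdot> c"
      using s by (rule effacedE)
    have "K' \<in> Obj C" using ses_Hom[OF s'] by simp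
    then obtain B iX iK pX pK where bp: "is_biproduct C X K' B iX iK pX pK"
      using biproduct_exists TX by blast
    note sB = biproduct_ses[OF bp] and B = is_biproductD[OF bp]
    note A = ses_Hom[OF s] ses_Hom[OF s'] h(1,2,5)[unfolded Hom_iff] refinesD(3)[OF r', unfolded Hom_iff]
    have gj: "g \<cdot> j' = c" using h(6) A by simp
    \<comment> \<open>\<open>b\<close> and \<open>j \<cdot> g\<close> agree along \<open>j'\<close>,
      so the difference descends to a lift \<open>u\<close> of \<open>d\<close> along
      \<open>q\<close>; \<open>j\<close> and \<open>u\<close> together define the map from the
      biproduct to \<open>N\<close>.\<close>
    let ?w = "b \<oplus> neg (j \<cdot> g)"
    have "?w \<in> Hom C N' N" "?w \<cdot> j' = Zero C L' N" using A by (simp_all add: Hom_iff gj h(4))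
    with s' obtain u where u: "u \<in> Hom C K' N" "u \<cdot> q' = ?w" by (rule ses_factor)
    have "(q \<cdot> u) \<cdot> q' = q \<cdot> ?w" using u A by (simp add: Hom_iff)
    also have "\<dots> = d \<cdot> q'" using A by (simp add: h(3) reassoc[OF A(10)])
    finally have qu: "q \<cdot> u = d"
      by (rule epicD[OF sesD(5)[OF s']]) (use u(1) A in \<open>simp_all add: Hom_iff\<close>)
    let ?b = "j \<cdot> pX \<oplus> u \<cdot> pK"
    have "?b \<in> Hom C B N" "q \<cdot> ?b = d \<cdot> pK" "j \<cdot> ?i = ?b \<cdot> iX"
      using A B(1-19) u(1) by (simp_all add: Hom_iff reassoc[OF A(10)] reassoc[OF qu])
    from refines.Cons[OF r' sB s this(1) i this(2,3)]
    have 1: "refines T ((iX, pK) # r') X r X ?i" unfolding r1 .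
    have l: "length r' = Suc m" using refinesD(4)[OF r'] r(2) r1 m by simp
    have "pX \<in> Hom C B X" "Zero C X Z \<cdot> pX = Zero C K' Z \<cdot> pK" "?i \<cdot> ?i = pX \<cdot> iX"
      using B zero_objectD(1)[OF Z] by (simp_all add: Hom_iff)
    from refines.Cons[OF refines_zero_resolution[OF Z refinesD(1)[OF r'] l] sB sz this(1) i this(2,3)]
    have 2: "refines T ((iX, pK) # r') X ?z X ?i" .
    have l': "length ((iX, pK) # r') = n" using l m by simp
    have "extension_map C n T X (?e ((iX, pK) # r')) e"
      using extension_map_arrows_iff[OF r(1,2) refinesD(1)[OF 1] l'] 1 r(3) n by simp
    moreover have "extension_map C n T X (?e ((iX, pK) # r')) (?e ?z)"
      using extension_map_arrows_iff[OF z refinesD(1)[OF 1] l'] 2 n by simp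
    ultimately show ?thesis
      by (blast intro: equivclp_trans[OF equivclp_sym] r_into_equivclp)
  qed
  moreover have "is_extension C n T X (?e ?z)"
    using is_extension_arrows[OF z(1)] unfolding z(2) by simp
  moreover have "trivial_extension C n T X (?e ?z)"
    unfolding m by (rule trivial_extension_arrows[OF Z TX])
  ultimately show ?thesis by (intro Ext_vanishesI)
qed

section \<open>Stable retracts and delooping levels\<close>

lemma conflation_ses: "conflation C E f g \<Longrightarrow> ses f g (Dom C f) (Cod C f) (Cod C g)"
  using is_kernelD(4)[of f g] is_kernelD(1,2)[of f g]
  unfolding conflation_def ses_def short_exact_def by (simp add: Hom_iff)

text \<open>The pushout along \<open>f\<close> is an extension of \<open>T\<close> by
  \<open>X\<close>, hence a conflation by extension-closedness, and it splits because
  \<open>T\<close> is projective. The resulting retraction \<open>u\<close> of \<open>j'\<close>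
  makes \<open>u \<cdot> b\<close> extend \<open>f\<close>.\<close>

lemma effaceable_one:
  assumes E: "extension_closed_subcategory C E" and T: "T \<in> Proj C E" and X: "X \<in> E"
  shows "effaceable T 1 X"
  unfolding effaceable_def
proof (intro allI ballI impI)
  fix r K f assume f: "f \<in> Hom C K X" and r: "resolution T r K" "length r = 1"
  obtain j q r1 N L where r1: "r = (j, q) # r1" "resolution T r1 L" and s: "ses j q K N L"
    using r by (auto elim: resolution_posE)
  have "r1 = []" using r(2) r1(1) by simp
  then have L: "L = T" using r1(2) by (auto elim: resolution.cases)
  obtain j' q' M b where s': "ses j' q' X M L" and b: "b \<in> Hom C N M" "b \<cdot> j = j' \<cdot> f" "q' \<cdot> b = q"
    by (rule ses_pushout[OF s f])
  note A = ses_Hom[OF s] ses_Hom[OF s'] b(1)[unfolded Hom_iff] f[unfolded Hom_iff]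
  have TE: "T \<in> E" using T unfolding Proj_def by blast
  have "M \<in> E"
    using E sesD(8)[OF s'] A X TE L unfolding extension_closed_subcategory_def by metis
  then have "conflation C E j' q'"
    using sesD(8)[OF s'] A X TE L unfolding conflation_def by simp
  moreover have "Ident C T \<in> Hom C T (Cod C q')" using A L by (simp add: Hom_iff)
  ultimately obtain t where t: "t \<in> Hom C T (Dom C q')" "q' \<cdot> t = Ident C T"
    using T unfolding Proj_def by blast
  have t': "t \<in> Arr C" "Dom C t = L" "Cod C t = M" "q' \<cdot> t = Ident C L"
    using t A L by (simp_all add: Hom_iff)
  let ?w = "Ident C M \<oplus> neg (t \<cdot> q')"
  have "?w \<in> Hom C M M" "q' \<cdot> ?w = Zero C M L"
    using A t' by (simp_all add: Hom_iff reassoc[OF t'(4)])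
  with s' obtain u where u: "u \<in> Hom C M X" "j' \<cdot> u = ?w" by (rule ses_lift)
  have "j' \<cdot> (u \<cdot> (b \<cdot> j)) = ?w \<cdot> (b \<cdot> j)"
    using A u(1) by (simp add: Hom_iff flip: u(2))
  also have "\<dots> = b \<cdot> j" using A t' by (simp add: reassoc[OF b(3)])
  also have "\<dots> = j' \<cdot> f" by (rule b(2))
  finally have "u \<cdot> (b \<cdot> j) = f"
    by (rule monicD[OF sesD(4)[OF s']]) (use A u(1) in \<open>simp_all add: Hom_iff\<close>)
  then have "(u \<cdot> b) \<cdot> j = f \<cdot> Ident C K" "u \<cdot> b \<in> Hom C N X"
    using A u(1) by (simp_all add: Hom_iff)
  then show "effaced T r K X f"
    using refines_refl[OF r(1)] s unfolding r1(1) by (intro effacedI)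
qed

lemma stable_rel_refl:
  assumes "P \<in> Proj C E" "E \<subseteq> Obj C" "f \<in> Hom C X Y" "X \<in> E" "Y \<in> E"
  shows "(f, f) \<in> stable_rel C E"
proof -
  have P: "P \<in> Obj C" using assms(1,2) unfolding Proj_def by blast
  have "f = f \<oplus> Zero C P Y \<cdot> Zero C X P" "Zero C X P \<in> Hom C X P" "Zero C P Y \<in> Hom C P Y"
    using P assms(3) by (simp_all add: Hom_iff)
  then show ?thesis using assms unfolding stable_rel_def by blast
qed

lemma stable_category_HomE:
  assumes "F \<in> Hom (stable_category C E) X Y" "P \<in> Proj C E" "E \<subseteq> Obj C"
  obtains f where "f \<in> Hom C X Y" "X \<in> E" "Y \<in> E" "f \<in> F"
proof -
  have "F \<in> {f \<in> Arr C. Dom C f \<in> E \<and> Cod C f \<in> E} // stable_rel C E"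
    using assms(1) unfolding Hom_def stable_category_def by simp
  then obtain f where F: "F = stable_rel C E `` {f}"
    and f': "f \<in> {f \<in> Arr C. Dom C f \<in> E \<and> Cod C f \<in> E}" by (rule quotientE)
  from f' have f: "f \<in> Arr C" "Dom C f \<in> E" "Cod C f \<in> E" by blast+
  have fF: "f \<in> F" unfolding F using stable_rel_refl[OF assms(2,3) arr_Hom[OF f(1)] f(2,3)] by blast
  \<comment> \<open>All members of a class share their endpoints, so \<open>the_elem\<close> reads
    off those of \<open>f\<close>.\<close>
  have "Dom C g \<in> {Dom C f} \<and> Cod C g \<in> {Cod C f}" if "g \<in> F" for g
    using that unfolding F stable_rel_def Hom_def by auto
  then have "Dom C ` F = {Dom C f}" "Cod C ` F = {Cod C f}" using fF by blast+
  then have "Dom C f = X" "Cod C f = Y"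
    using assms(1) unfolding Hom_def stable_category_def by simp_all
  then show ?thesis using that[of f] f fF by (simp add: Hom_def)
qed

lemma stable_retractE:
  assumes "stable_retract C E X Y" "P0 \<in> Proj C E" "E \<subseteq> Obj C"
  obtains u v P a b where "u \<in> Hom C X Y" "v \<in> Hom C Y X" "P \<in> Proj C E" "a \<in> Hom C X P"
    "b \<in> Hom C P X" "v \<cdot> u \<oplus> b \<cdot> a = Ident C X"
proof -
  obtain U V where U: "U \<in> Hom (stable_category C E) X Y" and V: "V \<in> Hom (stable_category C E) Y X"
    and UV: "V \<cdot>\<^bsub>stable_category C E\<^esub> U = Ident (stable_category C E) X"
    using assms(1) unfolding stable_retract_def is_retract_def by blast
  obtain u where u: "u \<in> Hom C X Y" "X \<in> E" "Y \<in> E" "u \<in> U" using U assms(2,3) by (rule stable_category_HomE)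
  obtain v where v: "v \<in> Hom C Y X" "v \<in> V" using V assms(2,3) by (rule stable_category_HomE)
  \<comment> \<open>A stable composite is the union of the classes of all composites of
    representatives. By reflexivity it contains \<open>v \<cdot> u\<close>, which \<open>UV\<close>
    places in the class of the identity.\<close>
  have "(v \<cdot> u, v \<cdot> u) \<in> stable_rel C E"
    using stable_rel_refl[OF assms(2,3) Comp_Hom[OF u(1) v(1)] u(2,2)] .
  then have "v \<cdot> u \<in> V \<cdot>\<^bsub>stable_category C E\<^esub> U"
    using u(4) v(2) unfolding stable_category_def by auto
  then have "(Ident C X, v \<cdot> u) \<in> stable_rel C E"
    unfolding UV by (simp add: stable_category_def)
  then obtain X' Y' P a b where *: "Ident C X \<in> Hom C X' Y'" "P \<in> Proj C E" "a \<in> Hom C X' P"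
      "b \<in> Hom C P Y'" "Ident C X = v \<cdot> u \<oplus> b \<cdot> a"
    unfolding stable_rel_def by blast
  have "X' = X" "Y' = X" using *(1) u(1) by (auto simp: Hom_iff)
  then show ?thesis using that[OF u(1) v(1) *(2)] *(3-5) by simp
qed

end

section \<open>Dimension shifting and delooping levels\<close>

lemma Inf_enat_leD:
  assumes "Inf {enat n | n. Q n} \<le> enat m"
  obtains n where "n \<le> m" "Q n"
proof -
  \<comment> \<open>The strict bound \<open>Suc m\<close> yields a member of the set, not only a
    bound on its infimum.\<close>
  have "Inf {enat n | n. Q n} < enat (Suc m)" by (rule le_less_trans[OF assms]) simp
  then obtain n where "Q n" "enat n < enat (Suc m)" unfolding Inf_less_iff by auto
  then show ?thesis using that[of n] by simp
qed

text \<open>\<open>M\<close> is the last degree in which Ext from \<open>T\<close> to projectives is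
  assumed to vanish; the theorem sets it to \<open>m + k + 1\<close>.\<close>

locale ext_vanishing_on_projectives = abelian_category C
  for C :: "('o, 'm, 'z) preadditive_category_scheme" (structure) +
  fixes E :: "'o set" and \<iota> \<pi> :: "'o \<Rightarrow> 'm" and T :: 'o and M :: nat
  assumes extension_closed: "extension_closed_subcategory C E"
    and syzygy_choice: "syzygy_choice C E \<iota> \<pi>"
    and T: "T \<in> Proj C E"
    and Ext_Proj: "\<lbrakk>P \<in> Proj C E; 2 \<le> j; j \<le> M\<rbrakk> \<Longrightarrow> Ext_vanishes C j T P"
begin

abbreviation \<Omega> :: "'o \<Rightarrow> 'o" where "\<Omega> \<equiv> syzygy C \<iota>"

lemma E_Obj: "E \<subseteq> Obj C"
  using extension_closed unfolding extension_closed_subcategory_def by blast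

lemma effaceable_Proj: "\<lbrakk>P \<in> Proj C E; 1 \<le> j; j \<le> M\<rbrakk> \<Longrightarrow> effaceable T j P"
  using effaceable_one[OF extension_closed T] Ext_vanishes_imp_effaceable[OF Ext_Proj]
  by (cases "j = 1") (auto simp: Proj_def)

lemma syzygy_ses:
  assumes "X \<in> E"
  obtains P where "P \<in> Proj C E" "ses (\<iota> X) (\<pi> X) (\<Omega> X) P X" "\<Omega> X \<in> E"
proof -
  have c: "conflation C E (\<iota> X) (\<pi> X)" "Cod C (\<pi> X) = X" "Dom C (\<pi> X) \<in> Proj C E"
    using syzygy_choice assms unfolding syzygy_choice_def by auto
  have s: "ses (\<iota> X) (\<pi> X) (\<Omega> X) (Cod C (\<iota> X)) X"
    using conflation_ses[OF c(1)] c(2) unfolding syzygy_def by simp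
  moreover have "\<Omega> X \<in> E" using c(1) unfolding conflation_def syzygy_def by blast
  ultimately show ?thesis using that[of "Cod C (\<iota> X)"] ses_Hom(3,5)[OF s] c(3) by simp
qed

lemma syzygy_power_in: "X \<in> E \<Longrightarrow> (\<Omega> ^^ n) X \<in> E"
  by (induction n) (auto elim: syzygy_ses)

text \<open>Starting from degree 1, where all of \<open>E\<close> is effaceable, each syzygy raises
  the degree by one; the step uses the projective cover term in the new degree.\<close>

lemma effaceable_syzygy_power:
  assumes "Y \<in> E" "Suc n \<le> M"
  shows "effaceable T (Suc n) ((\<Omega> ^^ n) Y)"
  using assms(2)
proof (induction n)
  case 0
  then show ?case using effaceable_one[OF extension_closed T assms(1)] by simp
next
  case (Suc n)
  obtain P where "P \<in> Proj C E" and s: "ses (\<iota> ((\<Omega> ^^ n) Y)) (\<pi> ((\<Omega> ^^ n) Y)) (\<Omega> ((\<Omega> ^^ n) Y)) P ((\<Omega> ^^ n) Y)"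
    using syzygy_ses[OF syzygy_power_in[OF assms(1)]] by blast
  then have "effaceable T (Suc (Suc n)) P" using effaceable_Proj Suc.prems by simp
  from effaceable_sub[OF s _ _ this] Suc show ?case by simp
qed

text \<open>The reverse shift uses projectives in degrees up to \<open>j + n - 1\<close> only, hence
  the bound \<open>Suc M\<close>.\<close>

lemma effaceable_of_syzygy_power:
  assumes "X \<in> E" "1 \<le> j" "effaceable T (j + n) ((\<Omega> ^^ n) X)" "j + n \<le> Suc M"
  shows "effaceable T j X"
  using assms(3,4)
proof (induction n)
  case (Suc n)
  obtain P where "P \<in> Proj C E" and s: "ses (\<iota> ((\<Omega> ^^ n) X)) (\<pi> ((\<Omega> ^^ n) X)) (\<Omega> ((\<Omega> ^^ n) X)) P ((\<Omega> ^^ n) X)"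
    using syzygy_ses[OF syzygy_power_in[OF assms(1)]] by blast
  then have "effaceable T (j + n) P" using effaceable_Proj Suc.prems assms(2) by simp
  from effaceable_quotient[OF s _ this] Suc assms(2) show ?case by simp
qed simp

text \<open>A stable retract becomes a genuine one after adding a projective \<open>P\<close> to the
  larger object, so Ext must vanish on \<open>P\<close> in degree \<open>k + 1 + n\<close> too. With
  n \<le> m this reaches degree \<open>m + k + 1\<close>.\<close>

lemma effaceable_of_dell:
  assumes X: "X \<in> E" and d: "dell C E \<iota> k X \<le> enat m" and m: "m + k + 1 \<le> M"
  shows "effaceable T (k + 1) X"
proof -
  obtain n where n: "n \<le> m" "\<exists>Y\<in>E. stable_retract C E ((\<Omega> ^^ n) X) ((\<Omega> ^^ (n + k)) Y)"
    using d unfolding dell_def by (rule Inf_enat_leD)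
  then obtain Y where Y: "Y \<in> E" and sr: "stable_retract C E ((\<Omega> ^^ n) X) ((\<Omega> ^^ (n + k)) Y)"
    by blast
  from sr T E_Obj obtain u v P a b where
    r: "u \<in> Hom C ((\<Omega> ^^ n) X) ((\<Omega> ^^ (n + k)) Y)" "v \<in> Hom C ((\<Omega> ^^ (n + k)) Y) ((\<Omega> ^^ n) X)"
      "a \<in> Hom C ((\<Omega> ^^ n) X) P" "b \<in> Hom C P ((\<Omega> ^^ n) X)"
      "v \<cdot> u \<oplus> b \<cdot> a = Ident C ((\<Omega> ^^ n) X)" and P: "P \<in> Proj C E"
    by (rule stable_retractE)
  have "effaceable T (k + 1 + n) ((\<Omega> ^^ (n + k)) Y)" "effaceable T (k + 1 + n) P"
    using effaceable_syzygy_power[OF Y, of "n + k"] effaceable_Proj[OF P, of "k + 1 + n"] n m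
    by (simp_all add: ac_simps)
  then have "effaceable T (k + 1 + n) ((\<Omega> ^^ n) X)" by (rule effaceable_retract[OF r])
  then show ?thesis using effaceable_of_syzygy_power[OF X, of "k + 1" n] n m by simp
qed

lemma effaceable_of_ddell:
  assumes "ddell C E \<iota> k X \<le> enat m" and M: "m + k + 1 \<le> M"
  shows "effaceable T (k + 1) X"
proof -
  from assms(1) obtain m' t D d where m': "m' \<le> m" "t \<le> m'" and ex: "admissibly_exact C E t D d X"
    and dell: "\<And>i. i \<le> t \<Longrightarrow> dell C E \<iota> (i + k) (D i) \<le> enat (m' - i)"
    unfolding ddell_def by (elim Inf_enat_leD) blast
  have DE: "D i \<in> E" if "i \<le> t" for i using ex that unfolding admissibly_exact_def by blast
  \<comment> \<open>Since i \<le> t \<le> m', the subtraction \<open>m' - i\<close> is not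
    truncated, and the bounds add up to m' + k + 1 \<le> M.\<close>
  have D: "effaceable T (i + k + 1) (D i)" if "i \<le> t" for i
    using effaceable_of_dell[OF DE[OF that] dell[OF that]] m' M that by simp
  show ?thesis
  proof (cases "t = 0")
    case True
    then have d: "d 0 \<in> Hom C (D 0) X" "iso_arr C (d 0)"
      using ex unfolding admissibly_exact_def by auto
    then obtain g where g: "g \<in> Hom C X (D 0)" "d 0 \<cdot> g = Ident C X"
      unfolding iso_arr_def by (auto simp: Hom_iff)
    \<comment> \<open>An isomorphism is a retract with zero projective part; \<open>T\<close> itself
      serves as the projective through which zero factors.\<close>
    have P: "T \<in> Obj C" "effaceable T (k + 1) T"
      using T E_Obj effaceable_Proj[OF T, of "k + 1"] M unfolding Proj_def by auto
    have "Zero C X T \<in> Hom C X T" "Zero C T X \<in> Hom C T X"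
      "d 0 \<cdot> g \<oplus> Zero C T X \<cdot> Zero C X T = Ident C X"
      using g d(1) P(1) by (simp_all add: Hom_iff)
    from effaceable_retract[OF g(1) d(1) this _ P(2)] show ?thesis using D[of 0] by simp
  next
    case False
    then obtain Z j q where Z: "Z 0 = X" "Z t = D t" and
      c: "\<And>i. i < t \<Longrightarrow> conflation C E (j i) (q i) \<and> j i \<in> Hom C (Z (Suc i)) (D i) \<and> q i \<in> Hom C (D i) (Z i)"
      using ex unfolding admissibly_exact_def by auto
    \<comment> \<open>\<open>Z (Suc i)\<close> in degree \<open>i + k + 2\<close> and
      \<open>D i\<close> in degree \<open>i + k + 1\<close> give \<open>Z i\<close> in degree
      \<open>i + k + 1\<close>, so descending from \<open>t\<close> to 0 ends in degree
      \<open>k + 1\<close>.\<close>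
    have "effaceable T (i + k + 1) (Z i)" if "i \<le> t" for i
      using that
    proof (induction rule: inc_induct)
      case base
      show ?case using D[of t] Z(2) by simp
    next
      case (step i)
      then have "ses (j i) (q i) (Z (Suc i)) (D i) (Z i)"
        using c[of i] conflation_ses[of E "j i" "q i"] by (simp add: Hom_iff)
      from effaceable_quotient[OF this, of "i + k + 1" T] show ?case using step D[of i] by simp
    qed
    from this[of 0] show ?thesis using Z(1) by simp
  qed
qed

end

theorem theorem3p16:
  fixes A :: "('o, 'm) preadditive_category" and E :: "'o set"
    and \<iota> \<pi> :: "'o \<Rightarrow> 'm" and T X :: 'o and k m :: nat
  assumes "abelian_category A"
    and "extension_closed_subcategory A E"
    and "idempotent_complete A E"
    and "enough_projectives A E"
    and "syzygy_choice A E \<iota> \<pi>"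
    and "T \<in> Proj A E"
    and "X \<in> E"
    and "k \<ge> 1"
    and "ddell A E \<iota> k X = enat m"
    and "\<And>P j. P \<in> Proj A E \<Longrightarrow> 2 \<le> j \<Longrightarrow> j \<le> m + k + 1 \<Longrightarrow> Ext_vanishes A j T P"
  shows "Ext_vanishes A (k + 1) T X"
proof -
  interpret abelian_category A by fact
  interpret ext_vanishing_on_projectives A E \<iota> \<pi> T "m + k + 1"
    by unfold_locales (use assms in auto)
  have "effaceable T (k + 1) X" using effaceable_of_ddell[of k X m] assms(9) by simp
  moreover have "T \<in> Obj A" "X \<in> Obj A" using E_Obj assms(6,7) unfolding Proj_def by auto
  ultimately show ?thesis using assms(8) by (intro effaceable_imp_Ext_vanishes) simp_all
qed

end
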